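(* Let $(\mathfrak{A},\mathsf{L})$ be a quantum compact metric space where $\mathsf{L}$ is lower semi-continuous over $\mathfrak{sa}(\mathfrak{A})$. Let $\alpha$ be a *-automorphism of $\mathfrak{A}$. The following two assertions are equivalent: (1) $\alpha(\mathrm{dom}(\mathsf{L}))=\mathrm{dom}(\mathsf{L})$; (2) there exists $C>0$ such that $C^{-1}\,\mathsf{L}\circ\alpha\leq\mathsf{L}\leq C\,\mathsf{L}\circ\alpha$.
   Context: For a unital C*-algebra $\mathfrak{A}$ with unit $1_{\mathfrak{A}}$, $\mathfrak{sa}(\mathfrak{A})$ is the space of self-adjoint elements and $\mathscr{S}(\mathfrak{A})$ the state space. A quantum compact metric space $(\mathfrak{A},\mathsf{L})$ is a unital C*-algebra $\mathfrak{A}$ with a seminorm $\mathsf{L}$ (called a Lip-norm) defined on a dense subspace $\mathrm{dom}(\mathsf{L})$ of $\mathfrak{sa}(\mathfrak{A})$ such that $\{a\in\mathrm{dom}(\mathsf{L}):\mathsf{L}(a)=0\}=\mathbb{R}1_{\mathfrak{A}}$ and the Monge-Kantorovich metric $\mathsf{mk}_{\mathsf{L}}(\varphi,\psi)=\sup\{|\varphi(a)-\psi(a)| : a\in\mathrm{dom}(\mathsf{L}),\ \mathsf{L}(a)\leq 1\}$ metrizes the weak* topology on $\mathscr{S}(\mathfrak{A})$. A Lip-norm takes the value $\infty$ outside its domain, and inequalities between seminorms are between $[0,\infty]$-valued functions on $\mathfrak{sa}(\mathfrak{A})$. $\mathsf{L}$ is lower semi-continuous on $\mathfrak{sa}(\mathfrak{A})$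 when $\{a\in\mathrm{dom}(\mathsf{L}):\mathsf{L}(a)\leq 1\}$ is norm closed in $\mathfrak{sa}(\mathfrak{A})$. *)

theory Defs
  imports "HOL-Analysis.Analysis"
begin

text \<open>Completeness comes from \<open>banach\<close>; \<open>real_normed_algebra_1\<close> makes the norm submultiplicative
  and the algebra nonzero. The complex scalars extend the real ones.\<close>

class unital_cstar_algebra = real_normed_algebra_1 + banach +
  fixes scaleC :: "complex \<Rightarrow> 'a \<Rightarrow> 'a"  (infixr \<open>*\<^sub>C\<close> 75)
    and adjoint :: "'a \<Rightarrow> 'a"
  assumes scaleC_add_right: "c *\<^sub>C (x + y) = c *\<^sub>C x + c *\<^sub>C y"
    and scaleC_add_left: "(c + d) *\<^sub>C x = c *\<^sub>C x + d *\<^sub>C x"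
    and scaleC_scaleC: "c *\<^sub>C d *\<^sub>C x = (c * d) *\<^sub>C x"
    and scaleC_of_real: "complex_of_real r *\<^sub>C x = r *\<^sub>R x"
    and mult_scaleC_left: "(c *\<^sub>C x) * y = c *\<^sub>C (x * y)"
    and mult_scaleC_right: "x * (c *\<^sub>C y) = c *\<^sub>C (x * y)"
    and norm_scaleC: "norm (c *\<^sub>C x) = cmod c * norm x"
    and adjoint_adjoint: "adjoint (adjoint x) = x"
    and adjoint_add: "adjoint (x + y) = adjoint x + adjoint y"
    and adjoint_scaleC: "adjoint (c *\<^sub>C x) = cnj c *\<^sub>C adjoint x"
    and adjoint_mult: "adjoint (x * y) = adjoint y * adjoint x"
    and cstar_identity: "norm (adjoint x * x) = (norm x)\<^sup>2"

definition self_adjoint :: "'a::unital_cstar_algebra set" where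
  "self_adjoint = {a. adjoint a = a}"

definition states :: "('a::unital_cstar_algebra \<Rightarrow> complex) set" where
  "states = {\<phi>. (\<forall>x y. \<phi> (x + y) = \<phi> x + \<phi> y) \<and> (\<forall>c x. \<phi> (c *\<^sub>C x) = c * \<phi> x) \<and>
                (\<forall>x. \<phi> (adjoint x * x) \<in> \<real>\<^sub>\<ge>\<^sub>0) \<and> \<phi> 1 = 1}"

text \<open>The weak* topology is the topology of pointwise convergence on the algebra.\<close>

definition weak_star_states :: "('a::unital_cstar_algebra \<Rightarrow> complex) topology" where
  "weak_star_states = subtopology (product_topology (\<lambda>_. euclidean) UNIV) states"

definition star_automorphism :: "('a::unital_cstar_algebra \<Rightarrow> 'a) \<Rightarrow> bool" where
  "star_automorphism \<alpha> \<longleftrightarrow> bij \<alpha> \<and>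
     (\<forall>x y. \<alpha> (x + y) = \<alpha> x + \<alpha> y) \<and> (\<forall>c x. \<alpha> (c *\<^sub>C x) = c *\<^sub>C \<alpha> x) \<and>
     (\<forall>x y. \<alpha> (x * y) = \<alpha> x * \<alpha> y) \<and> (\<forall>x. \<alpha> (adjoint x) = adjoint (\<alpha> x))"

text \<open>A Lip-norm is an extended-real-valued function, infinite outside its domain. Only its values
  on self-adjoint elements are meaningful: its values elsewhere are never used.\<close>

definition lip_dom :: "('a::unital_cstar_algebra \<Rightarrow> ennreal) \<Rightarrow> 'a set" where
  "lip_dom L = {a \<in> self_adjoint. L a < \<infinity>}"

definition mk_dist :: "('a::unital_cstar_algebra \<Rightarrow> ennreal) \<Rightarrow>
    ('a \<Rightarrow> complex) \<Rightarrow> ('a \<Rightarrow> complex) \<Rightarrow> ennreal" where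
  "mk_dist L \<phi> \<psi> = (SUP a\<in>{a \<in> lip_dom L. L a \<le> 1}. ennreal (cmod (\<phi> a - \<psi> a)))"

text \<open>The supremum is required to be finite before it is turned into a real-valued metric, since
  \<open>enn2real\<close> sends infinity to zero.\<close>

definition mk_metrizes_weak_star :: "('a::unital_cstar_algebra \<Rightarrow> ennreal) \<Rightarrow> bool" where
  "mk_metrizes_weak_star L \<longleftrightarrow>
     (\<forall>\<phi>\<in>states. \<forall>\<psi>\<in>states. mk_dist L \<phi> \<psi> < \<infinity>) \<and>
     Metric_space states (\<lambda>\<phi> \<psi>. enn2real (mk_dist L \<phi> \<psi>)) \<and>
     Metric_space.mtopology states (\<lambda>\<phi> \<psi>. enn2real (mk_dist L \<phi> \<psi>)) = weak_star_states"

definition quantum_compact_metric_space :: "('a::unital_cstar_algebra \<Rightarrow> ennreal) \<Rightarrow> bool" where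
  "quantum_compact_metric_space L \<longleftrightarrow>
     subspace (lip_dom L) \<and> self_adjoint \<subseteq> closure (lip_dom L) \<and>
     (\<forall>a\<in>lip_dom L. \<forall>b\<in>lip_dom L. L (a + b) \<le> L a + L b) \<and>
     (\<forall>a\<in>lip_dom L. \<forall>t::real. L (t *\<^sub>R a) = ennreal \<bar>t\<bar> * L a) \<and>
     {a \<in> lip_dom L. L a = 0} = range (\<lambda>t::real. t *\<^sub>R 1) \<and>
     mk_metrizes_weak_star L"

definition lip_lower_semicontinuous :: "('a::unital_cstar_algebra \<Rightarrow> ennreal) \<Rightarrow> bool" where
  "lip_lower_semicontinuous L \<longleftrightarrow>
     closedin (top_of_set self_adjoint) {a \<in> lip_dom L. L a \<le> 1}"

end

(* On dom L / R1 the Lip-norm L controls the norm: states separate self-adjoint elements from 0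
   quantitatively, and the weak* compact state space has finite diameter for mk_L, so every a with
   L a <= 1 is within a fixed distance R of R1. The closed convex set of all a with L a <= 1 and
   norm a <= 1 is the union of its closed subsets where L o alpha <= n; by Baire one of them has
   interior, so L o alpha is bounded on it, and then by homogeneity and invariance under R1 it is
   bounded by a multiple of L. The same argument applies to the inverse of alpha.

   The states come from the Hahn-Banach theorem applied to the smallest t with a <= t 1, where the
   order is given by the cone of all self-adjoint x with norm (t 1 - x) <= t for some t. That squares
   and the elements x* x lie in this cone is shown without spectral theory, using only square roots
   and the C*-identity. *)

theory Submission
  imports Defs
begin

section \<open>The adjoint and square roots\<close>

lemma adjoint_scaleR: "adjoint (r *\<^sub>R x) = r *\<^sub>R adjoint (x::'a::unital_cstar_algebra)"
  by (metis adjoint_scaleC complex_cnj_complex_of_real scaleC_of_real)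

lemma adjoint_minus: "adjoint (- x) = - adjoint (x::'a::unital_cstar_algebra)"
  using adjoint_scaleR[of "-1" x] by simp

lemma adjoint_diff: "adjoint (x - y) = adjoint x - adjoint (y::'a::unital_cstar_algebra)"
  using adjoint_add[of x "- y"] by (simp add: adjoint_minus)

lemma adjoint_zero [simp]: "adjoint (0::'a::unital_cstar_algebra) = 0"
  using adjoint_scaleR[of 0 0] by simp

lemma adjoint_one [simp]: "adjoint (1::'a::unital_cstar_algebra) = 1"
  by (metis adjoint_adjoint adjoint_mult mult_1_left mult_1_right)

text \<open>The C*-identity and submultiplicativity give
  \<open>norm y * norm y <= norm (adjoint y) * norm y\<close>; cancelling \<open>norm y\<close> and
  applying this to \<open>x\<close> and \<open>adjoint x\<close> yields both inequalities.\<close>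

lemma norm_adjoint [simp]: "norm (adjoint x) = norm (x::'a::unital_cstar_algebra)"
proof -
  have le: "norm y \<le> norm (adjoint y)" for y :: 'a
  proof (cases "y = 0")
    case False
    have "norm y * norm y \<le> norm (adjoint y) * norm y"
      using norm_mult_ineq[of "adjoint y" y] by (simp add: cstar_identity power2_eq_square)
    then show ?thesis using False by simp
  qed simp
  show ?thesis using le[of x] le[of "adjoint x"] by (simp add: adjoint_adjoint)
qed

lemma bounded_linear_adjoint: "bounded_linear (adjoint :: 'a::unital_cstar_algebra \<Rightarrow> 'a)"
  by (intro bounded_linear_intro[where K = 1]) (auto simp: adjoint_add adjoint_scaleR)

lemma closed_self_adjoint: "closed (self_adjoint :: 'a::unital_cstar_algebra set)"
  unfolding self_adjoint_def
  by (intro closed_Collect_eq linear_continuous_on bounded_linear_adjoint continuous_on_id)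

lemma subspace_self_adjoint: "subspace (self_adjoint :: 'a::unital_cstar_algebra set)"
  by (simp add: subspace_def self_adjoint_def adjoint_add adjoint_scaleR)

lemma one_self_adjoint [simp]: "1 \<in> self_adjoint"
  by (simp add: self_adjoint_def)

lemma scaleR_one_self_adjoint [simp]: "t *\<^sub>R 1 \<in> self_adjoint"
  by (simp add: self_adjoint_def adjoint_scaleR)

lemma self_adjoint_square: "x \<in> self_adjoint \<Longrightarrow> x * x \<in> self_adjoint"
  by (simp add: self_adjoint_def adjoint_mult)

lemma norm_square_self_adjoint: "x \<in> self_adjoint \<Longrightarrow> norm (x * x) = (norm x)\<^sup>2"
  using cstar_identity[of x] by (simp add: self_adjoint_def)

text \<open>A fixed point of \<open>w = (1/2) *\<^sub>R (z + w * w)\<close> solves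
  \<open>(1 - w) * (1 - w) = 1 - z\<close>. Iteration from 0 converges because it is dominated by
  the scalar iteration for 1 in place of \<open>z\<close>; self-adjointness, the norm bound and
  commutation hold for each iterate and pass to the limit.\<close>

lemma sqrt_one_minus_exists:
  fixes z :: "'a::unital_cstar_algebra"
  assumes z: "norm z \<le> 1" "z \<in> self_adjoint"
  obtains w where "(1 - w) * (1 - w) = 1 - z" "w \<in> self_adjoint" "norm w \<le> 1"
    "\<And>x. x * z = z * x \<Longrightarrow> x * w = w * x"
proof -
  \<comment> \<open>\<open>r\<close> is the scalar majorant: it bounds the norms of the iterates,
    and its increments bound theirs.\<close>
  define r where "r = rec_nat (0::real) (\<lambda>_ u. (1 + u * u) / 2)"
  define w where "w = rec_nat (0::'a) (\<lambda>_ u. (1/2) *\<^sub>R (z + u * u))"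
  have r0: "r 0 = 0" and rS: "r (Suc n) = (1 + r n * r n) / 2" for n
    by (auto simp: r_def)
  have w0: "w 0 = 0" and wS: "w (Suc n) = (1/2) *\<^sub>R (z + w n * w n)" for n
    by (auto simp: w_def)
  have r: "0 \<le> r n \<and> r n \<le> 1" for n
  proof (induction n)
    case (Suc n)
    then have "r n * r n \<le> 1" by (simp add: mult_le_one)
    then show ?case by (simp add: rS)
  qed (simp add: r0)
  \<comment> \<open>The increment is half the square of \<open>1 - r n\<close>.\<close>
  have r_mono: "r n \<le> r (Suc n)" for n
    using sum_squares_ge_zero[of "1 - r n" 0] by (simp add: rS algebra_simps)
  have comm: "x * w n = w n * x" if "x * z = z * x" for x n
  proof (induction n)
    case (Suc n)
    have "x * (w n * w n) = w n * w n * x"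
      using Suc by (metis mult.assoc)
    then show ?case using that by (simp add: wS algebra_simps)
  qed (simp add: w0)
  have norm_w: "norm (w n) \<le> r n" for n
  proof (induction n)
    case (Suc n)
    have "norm (w n * w n) \<le> r n * r n"
      using Suc norm_mult_ineq[of "w n" "w n"] mult_mono[OF Suc Suc] r[of n] by fastforce
    then have "norm (z + w n * w n) \<le> 1 + r n * r n"
      using z(1) norm_triangle_ineq[of z "w n * w n"] by linarith
    then show ?case by (simp add: wS rS)
  qed (simp add: w0 r0)
  have step: "norm (w (Suc n) - w n) \<le> r (Suc n) - r n" for n
  proof (induction n)
    case 0
    then show ?case using z by (simp add: w0 r0 wS rS)
  next
    case (Suc n)
    \<comment> \<open>Since consecutive iterates commute, the difference of their squares factors as
      in the scalar case.\<close>
    have c: "w (Suc n) * w n = w n * w (Suc n)"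
      using comm[of "w n" "Suc n"] comm[of z n] by simp
    have "w (Suc (Suc n)) - w (Suc n) = (1/2) *\<^sub>R ((w (Suc n) + w n) * (w (Suc n) - w n))"
      unfolding wS[of "Suc n"] using c by (subst (2) wS) (simp add: algebra_simps)
    also have "norm \<dots> \<le> (1/2) * ((r (Suc n) + r n) * (r (Suc n) - r n))"
    proof -
      have "norm (w (Suc n) + w n) \<le> r (Suc n) + r n"
        using norm_triangle_ineq norm_w by (meson add_mono order_trans)
      then have "norm (w (Suc n) + w n) * norm (w (Suc n) - w n) \<le> (r (Suc n) + r n) * (r (Suc n) - r n)"
        using Suc r by (intro mult_mono) auto
      then show ?thesis
        using norm_mult_ineq[of "w (Suc n) + w n" "w (Suc n) - w n"] by simp
    qed
    also have "\<dots> = r (Suc (Suc n)) - r (Suc n)"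
      unfolding rS[of "Suc n"] using rS[of n] by (simp add: algebra_simps)
    finally show ?case .
  qed
  have "incseq r" by (simp add: incseq_SucI r_mono)
  then obtain l where "r \<longlonglongrightarrow> l"
    using incseq_convergent[of r 1] r by blast
  then have Cr: "Cauchy r" by (rule LIMSEQ_imp_Cauchy)
  have dist: "norm (w n - w m) \<le> r n - r m" if "m \<le> n" for m n
    using that
  proof (induction n rule: dec_induct)
    case (step n)
    then show ?case using \<open>\<And>n. norm (w (Suc n) - w n) \<le> r (Suc n) - r n\<close>[of n]
        norm_triangle_ineq[of "w (Suc n) - w n" "w n - w m"] by simp
  qed simp
  have "Cauchy w"
  proof (rule metric_CauchyI)
    fix e :: real assume "e > 0"
    then obtain M where M: "\<And>m n. m \<ge> M \<Longrightarrow> n \<ge> M \<Longrightarrow> dist (r m) (r n) < e"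
      using Cr by (meson metric_CauchyD)
    have "dist (w m) (w n) \<le> dist (r m) (r n)" for m n
      using dist[of m n] dist[of n m] by (cases "m \<le> n") (auto simp: dist_norm norm_minus_commute)
    then show "\<exists>M. \<forall>m\<ge>M. \<forall>n\<ge>M. dist (w m) (w n) < e"
      using M by (meson le_less_trans)
  qed
  then obtain v where v: "w \<longlonglongrightarrow> v" using Cauchy_convergent convergent_def by blast
  have "(\<lambda>n. w (Suc n)) \<longlonglongrightarrow> (1/2) *\<^sub>R (z + v * v)"
    unfolding wS by (intro tendsto_intros v)
  then have veq: "v = (1/2) *\<^sub>R (z + v * v)"
    using LIMSEQ_unique LIMSEQ_Suc[OF v] by blast
  have "2 *\<^sub>R v = z + v * v"
    by (subst veq) simp
  then have "(1 - v) * (1 - v) = 1 - z"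
    by (simp add: algebra_simps scaleR_2)
  moreover have "x * v = v * x" if "x * z = z * x" for x
  proof -
    have "(\<lambda>n. x * w n) \<longlonglongrightarrow> x * v" "(\<lambda>n. w n * x) \<longlonglongrightarrow> v * x" by (intro tendsto_intros v)+
    then show ?thesis using comm[OF that] LIMSEQ_unique by simp
  qed
  moreover have "v \<in> self_adjoint"
  proof -
    have "w n \<in> self_adjoint" for n
    proof (induction n)
      case 0
      show ?case using subspace_0[OF subspace_self_adjoint] by (simp add: w0)
    next
      case (Suc n)
      then show ?case unfolding wS using z(2)
        by (intro subspace_scale subspace_add subspace_self_adjoint self_adjoint_square)
    qed
    then show ?thesis using closed_sequentially[OF closed_self_adjoint _ v] by blast
  qed
  moreover have "norm v \<le> 1"
    using norm_w r by (intro LIMSEQ_le_const2[OF tendsto_norm[OF v]]) (meson order_trans)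
  ultimately show ?thesis using that by blast
qed

section \<open>The positive cone\<close>

text \<open>For self-adjoint \<open>x\<close> the inequality says that the spectrum lies between 0
  and \<open>2 * t\<close>, so these are the usual positive elements, described by the norm alone.
  Such a \<open>t\<close> is automatically nonnegative.\<close>

definition pos_cone :: "'a::unital_cstar_algebra set" where
  "pos_cone = {x \<in> self_adjoint. \<exists>t. norm (t *\<^sub>R 1 - x) \<le> t}"

lemma pos_cone_self_adjoint: "x \<in> pos_cone \<Longrightarrow> x \<in> self_adjoint"
  by (simp add: pos_cone_def)

lemma pos_cone_add:
  assumes "x \<in> pos_cone" "y \<in> pos_cone" shows "x + y \<in> pos_cone"
proof -
  obtain s t where st: "norm (s *\<^sub>R 1 - x) \<le> s" "norm (t *\<^sub>R 1 - y) \<le> t"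
    using assms by (auto simp: pos_cone_def)
  have "(s + t) *\<^sub>R 1 - (x + y) = (s *\<^sub>R 1 - x) + (t *\<^sub>R 1 - y)"
    by (simp add: algebra_simps)
  then have "norm ((s + t) *\<^sub>R 1 - (x + y)) \<le> s + t"
    using st norm_triangle_ineq[of "s *\<^sub>R 1 - x" "t *\<^sub>R 1 - y"] by (metis add_mono order_trans)
  moreover have "x + y \<in> self_adjoint"
    using assms by (simp add: pos_cone_self_adjoint subspace_add subspace_self_adjoint)
  ultimately show ?thesis by (auto simp: pos_cone_def)
qed

lemma pos_cone_scaleR:
  assumes "x \<in> pos_cone" "c \<ge> 0" shows "c *\<^sub>R x \<in> pos_cone"
proof -
  obtain t where t: "norm (t *\<^sub>R 1 - x) \<le> t" using assms by (auto simp: pos_cone_def)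
  have "norm ((c * t) *\<^sub>R 1 - c *\<^sub>R x) = c * norm (t *\<^sub>R 1 - x)"
    using assms(2) by (metis abs_of_nonneg norm_scaleR scaleR_right_diff_distrib scaleR_scaleR)
  also have "\<dots> \<le> c * t" using t assms(2) by (rule mult_left_mono)
  finally show ?thesis
    using assms(1) subspace_scale[OF subspace_self_adjoint]
    by (auto simp: pos_cone_def)
qed

lemma scaleR_one_pos_cone_iff: "t *\<^sub>R 1 \<in> (pos_cone :: 'a::unital_cstar_algebra set) \<longleftrightarrow> t \<ge> 0"
proof
  assume "t *\<^sub>R 1 \<in> (pos_cone :: 'a set)"
  then obtain s where "norm (s *\<^sub>R 1 - t *\<^sub>R (1::'a)) \<le> s" by (auto simp: pos_cone_def)
  then have "\<bar>s - t\<bar> \<le> s" by (simp flip: scaleR_left_diff_distrib)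
  then show "t \<ge> 0" by linarith
next
  assume "t \<ge> 0"
  then have "norm (t *\<^sub>R 1 - t *\<^sub>R (1::'a)) \<le> t" by simp
  then show "t *\<^sub>R 1 \<in> (pos_cone :: 'a set)" unfolding pos_cone_def using scaleR_one_self_adjoint by blast
qed

lemma norm_le_imp_diff_pos_cone:
  assumes "x \<in> self_adjoint" "norm x \<le> t" shows "t *\<^sub>R 1 - x \<in> pos_cone"
proof -
  have "norm (t *\<^sub>R 1 - (t *\<^sub>R 1 - x)) \<le> t" using assms by simp
  moreover have "t *\<^sub>R 1 - x \<in> self_adjoint"
    using assms by (simp add: subspace_diff subspace_self_adjoint)
  ultimately show ?thesis unfolding pos_cone_def by blast
qed

text \<open>Dividing by \<open>t\<close> reduces to the root \<open>1 - w\<close> of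
  \<open>1 - z\<close>, where \<open>z\<close> has norm at most 1; the bound
  \<open>norm w <= 1\<close> puts this root in the cone. The commutation clause lets roots of
  commuting elements be combined later.\<close>

lemma pos_cone_sqrt:
  assumes x: "x \<in> pos_cone"
  obtains y where "y \<in> self_adjoint" "y * y = x" "y \<in> pos_cone" "\<And>c. c * x = x * c \<Longrightarrow> c * y = y * c"
proof -
  obtain t where t: "norm (t *\<^sub>R 1 - x) \<le> t" using x by (auto simp: pos_cone_def)
  then have "t \<ge> 0" using norm_ge_zero order_trans by blast
  show ?thesis
  proof (cases "t = 0")
    case True
    then have "x = 0" using t by simp
    then show ?thesis using that[of 0] subspace_0[OF subspace_self_adjoint] 
        scaleR_one_pos_cone_iff[of 0, where ?'a = 'a] by simp
  next
    case False
    with \<open>t \<ge> 0\<close> have t0: "t > 0" by simp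
    define z where "z = 1 - (1 / t) *\<^sub>R x"
    have "z = (1 / t) *\<^sub>R (t *\<^sub>R 1 - x)" using t0 by (simp add: z_def algebra_simps)
    then have "norm z = norm (t *\<^sub>R 1 - x) / t" using t0 by simp
    then have "norm z \<le> 1" using t t0 by simp
    moreover have "z \<in> self_adjoint"
      unfolding z_def using pos_cone_self_adjoint[OF x] one_self_adjoint
      by (intro subspace_diff subspace_scale subspace_self_adjoint) auto
    ultimately obtain w where w: "(1 - w) * (1 - w) = 1 - z" "w \<in> self_adjoint" "norm w \<le> 1"
        "\<And>c. c * z = z * c \<Longrightarrow> c * w = w * c"
      using sqrt_one_minus_exists by blast
    show ?thesis
    proof (rule that[of "sqrt t *\<^sub>R (1 - w)"])
      show "sqrt t *\<^sub>R (1 - w) \<in> self_adjoint"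
        using w(2) by (intro subspace_diff subspace_scale subspace_self_adjoint) auto
      show "sqrt t *\<^sub>R (1 - w) * sqrt t *\<^sub>R (1 - w) = x"
        using w(1) t0 by (simp add: z_def)
      show "sqrt t *\<^sub>R (1 - w) \<in> pos_cone"
        using norm_le_imp_diff_pos_cone[OF w(2,3)] t0 by (simp add: pos_cone_scaleR)
      show "c * sqrt t *\<^sub>R (1 - w) = sqrt t *\<^sub>R (1 - w) * c" if "c * x = x * c" for c
        using w(4)[of c] that by (simp add: z_def algebra_simps)
    qed
  qed
qed

section \<open>Complex scalars, norm bounds from the cone, and positivity of
  \<open>adjoint x * x\<close>\<close>

lemma scaleC_zero_right [simp]: "c *\<^sub>C (0::'a::unital_cstar_algebra) = 0"
  using scaleC_add_right[of c 0 "0::'a"] by simp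

lemma scaleC_minus_right: "c *\<^sub>C (- x) = - (c *\<^sub>C (x::'a::unital_cstar_algebra))"
  using scaleC_add_right[of c x "- x"] by (simp add: eq_neg_iff_add_eq_0 add.commute)

lemma scaleC_minus_left: "(- c) *\<^sub>C x = - (c *\<^sub>C (x::'a::unital_cstar_algebra))"
  using scaleC_add_left[of c "- c" x] scaleC_of_real[of 0 x]
  by (simp add: eq_neg_iff_add_eq_0 add.commute)

lemma scaleC_diff_right: "c *\<^sub>C (x - y) = c *\<^sub>C x - c *\<^sub>C (y::'a::unital_cstar_algebra)"
  using scaleC_add_right[of c x "- y"] by (simp add: scaleC_minus_right)

lemma scaleC_one [simp]: "1 *\<^sub>C x = (x::'a::unital_cstar_algebra)"
  using scaleC_of_real[of 1 x] by simp

lemma scaleC_ii_ii: "\<i> *\<^sub>C \<i> *\<^sub>C x = - (x::'a::unital_cstar_algebra)"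
  by (simp add: scaleC_scaleC scaleC_minus_left)

lemma scaleC_scaleR: "c *\<^sub>C (r *\<^sub>R x) = r *\<^sub>R (c *\<^sub>C (x::'a::unital_cstar_algebra))"
  by (simp add: scaleC_scaleC mult.commute flip: scaleC_of_real)

text \<open>For commuting self-adjoint \<open>y\<close>, \<open>w\<close> the element \<open>u = y + i w\<close> satisfies \<open>u\<^sup>* u = y\<^sup>2 + w\<^sup>2\<close>,
  and both \<open>y\<close> and \<open>w\<close> are averages of \<open>u\<close> and \<open>u\<^sup>*\<close> up to a phase.\<close>

lemma norm_le_of_sum_squares:
  fixes y w :: "'a::unital_cstar_algebra"
  assumes yw: "y \<in> self_adjoint" "w \<in> self_adjoint" "y * w = w * y" "y * y + w * w = t *\<^sub>R 1"
  shows "norm (y * y) \<le> \<bar>t\<bar>"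
proof -
  define u where "u = y + \<i> *\<^sub>C w"
  have au: "adjoint u = y - \<i> *\<^sub>C w"
    using yw by (simp add: u_def self_adjoint_def adjoint_add adjoint_scaleC scaleC_minus_left)
  have "adjoint u * u = t *\<^sub>R 1"
    unfolding au using yw(3,4)
    by (simp add: u_def algebra_simps mult_scaleC_left mult_scaleC_right scaleC_ii_ii
        scaleC_add_right scaleC_diff_right)
  then have nu: "(norm u)\<^sup>2 = \<bar>t\<bar>" using cstar_identity[of u] by simp
  have "u + adjoint u = 2 *\<^sub>R y" unfolding au by (simp add: u_def scaleR_2)
  then have "y = (1/2) *\<^sub>R (u + adjoint u)" by simp
  then have "norm y \<le> norm u"
    using norm_triangle_ineq[of u "adjoint u"] by simp
  then show ?thesis
    using nu norm_square_self_adjoint[OF yw(1)] by (metis norm_ge_zero power_mono)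
qed

text \<open>With \<open>n = norm (y * y)\<close>, the element \<open>n *\<^sub>R 1 - y * y\<close>
  has a root \<open>w\<close> commuting with \<open>y\<close>, and the two squares add up to
  \<open>n *\<^sub>R 1\<close>. The bound for sums of squares then controls
  \<open>norm (w * w)\<close>, so \<open>n\<close> witnesses membership in the cone.\<close>

lemma square_pos_cone:
  assumes y: "y \<in> self_adjoint" 
  shows "y * y \<in> pos_cone" "norm (norm (y * y) *\<^sub>R 1 - y * y) \<le> norm (y * y)"
proof -
  define n where "n = norm (y * y)"
  have sa: "y * y \<in> self_adjoint" using y by (rule self_adjoint_square)
  have "n *\<^sub>R 1 - y * y \<in> pos_cone" using norm_le_imp_diff_pos_cone[OF sa] n_def by simp
  then obtain w where w: "w \<in> self_adjoint" "w * w = n *\<^sub>R 1 - y * y"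
      "\<And>c. c * (n *\<^sub>R 1 - y * y) = (n *\<^sub>R 1 - y * y) * c \<Longrightarrow> c * w = w * c"
    using pos_cone_sqrt by blast
  have "y * w = w * y" using w(3)[of y] by (simp add: algebra_simps)
  then have "norm (w * w) \<le> \<bar>n\<bar>"
    using y w(1,2) by (intro norm_le_of_sum_squares[of w y]) auto
  then show *: "norm (norm (y * y) *\<^sub>R 1 - y * y) \<le> norm (y * y)"
    using w(2) by (simp add: n_def)
  show "y * y \<in> pos_cone" using * sa unfolding pos_cone_def by blast
qed

lemma pos_cone_norm_diff:
  assumes "x \<in> pos_cone" shows "norm (norm x *\<^sub>R 1 - x) \<le> norm x"
  using pos_cone_sqrt[OF assms] square_pos_cone(2) by metis

text \<open>The roots of \<open>x\<close> and of \<open>t *\<^sub>R 1 - x\<close> commute and their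
  squares add up to \<open>t *\<^sub>R 1\<close>, so the bound for sums of squares applies.\<close>

lemma pos_cone_norm_le:
  fixes x :: "'a::unital_cstar_algebra"
  assumes x: "x \<in> pos_cone" and tx: "t *\<^sub>R 1 - x \<in> pos_cone"
  shows "norm x \<le> t"
proof -
  have "t *\<^sub>R (1::'a) \<in> pos_cone" using pos_cone_add[OF assms] by simp
  then have t: "t \<ge> 0" by (simp add: scaleR_one_pos_cone_iff)
  obtain y where y: "y \<in> self_adjoint" "y * y = x" "\<And>c. c * x = x * c \<Longrightarrow> c * y = y * c"
    using pos_cone_sqrt[OF x] by blast
  obtain w where w: "w \<in> self_adjoint" "w * w = t *\<^sub>R 1 - x"
      "\<And>c. c * (t *\<^sub>R 1 - x) = (t *\<^sub>R 1 - x) * c \<Longrightarrow> c * w = w * c"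
    using pos_cone_sqrt[OF tx] by blast
  have "y * w = w * y" using w(3)[of y] y(2) by (auto simp add: algebra_simps)
  then have "norm (y * y) \<le> \<bar>t\<bar>"
    using y(1,2) w(1,2) by (intro norm_le_of_sum_squares[of y w]) auto
  then show ?thesis using y(2) t by simp
qed

text \<open>Each of the two cone elements is \<open>(2 * t) *\<^sub>R 1\<close> minus the other,
  hence has norm at most \<open>2 * t\<close>, and \<open>a\<close> is half their difference. The
  factor 2 is not sharp but harmless.\<close>

lemma norm_le_of_pos_cone:
  fixes a :: "'a::unital_cstar_algebra"
  assumes "t *\<^sub>R 1 - a \<in> pos_cone" "t *\<^sub>R 1 + a \<in> pos_cone"
  shows "norm a \<le> 2 * t"
proof -
  have d: "(2 * t) *\<^sub>R (1::'a) = t *\<^sub>R 1 + t *\<^sub>R 1" by (simp flip: scaleR_left_distrib)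
  have "norm (t *\<^sub>R 1 - a) \<le> 2 * t" "norm (t *\<^sub>R 1 + a) \<le> 2 * t"
    using assms by (auto intro!: pos_cone_norm_le simp: d)
  moreover have "2 *\<^sub>R a = (t *\<^sub>R 1 + a) - (t *\<^sub>R 1 - a)" by (simp add: scaleR_2)
  then have "2 * norm a \<le> norm (t *\<^sub>R 1 + a) + norm (t *\<^sub>R 1 - a)"
    by (metis norm_scaleR norm_triangle_ineq4 abs_numeral)
  ultimately show ?thesis by simp
qed

lemma real_part_decomposition:
  fixes x :: "'a::unital_cstar_algebra"
  obtains h k where "h \<in> self_adjoint" "k \<in> self_adjoint" "x = h + \<i> *\<^sub>C k"
    "norm h \<le> norm x" "norm k \<le> norm x"
proof -
  define h where "h = (1/2) *\<^sub>R (x + adjoint x)"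
  define k where "k = (1/2) *\<^sub>R (\<i> *\<^sub>C (adjoint x - x))"
  have "h \<in> self_adjoint"
    by (simp add: h_def self_adjoint_def adjoint_add adjoint_scaleR adjoint_adjoint add.commute)
  moreover have "k \<in> self_adjoint"
    by (simp add: k_def self_adjoint_def adjoint_diff adjoint_scaleR adjoint_scaleC
        adjoint_adjoint scaleC_minus_left scaleC_diff_right)
  moreover have "x = h + \<i> *\<^sub>C k"
  proof -
    have "h + \<i> *\<^sub>C k = (1/2) *\<^sub>R ((x + adjoint x) - (adjoint x - x))"
      by (simp add: h_def k_def scaleC_scaleR scaleC_ii_ii algebra_simps)
    also have "\<dots> = x" by (simp flip: scaleR_2)
    finally show ?thesis ..
  qed
  moreover have "norm h \<le> norm x" using norm_triangle_ineq[of x "adjoint x"] by (simp add: h_def)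
  moreover have "norm k \<le> norm x" using norm_triangle_ineq4[of "adjoint x" x] by (simp add: k_def norm_scaleC)
  ultimately show ?thesis using that by blast
qed

text \<open>If \<open>c\<^sup>*c = -s\<^sup>2\<close> then \<open>cc\<^sup>* \<ge> 0\<close>. With \<open>n = \<parallel>c\<parallel>\<^sup>2\<close> and \<open>A = n + s\<^sup>2\<close>, of norm \<open>2n\<close>, the identity
  \<open>c A = (n - cc\<^sup>*) c\<close> gives \<open>A\<^sup>2 = n A - c\<^sup>* (n - cc\<^sup>*) c\<close>, whose norm is at most \<open>3n\<^sup>2\<close>; so \<open>n = 0\<close>.\<close>

lemma adjoint_mult_self_neg_square:
  fixes c s :: "'a::unital_cstar_algebra"
  assumes s: "s \<in> self_adjoint" and cs: "adjoint c * c = - (s * s)"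
  shows "c = 0"
proof -
  obtain h k where hk: "h \<in> self_adjoint" "k \<in> self_adjoint" "c = h + \<i> *\<^sub>C k"
    using real_part_decomposition by blast
  have ac: "adjoint c = h - \<i> *\<^sub>C k"
    using hk by (simp add: self_adjoint_def adjoint_add adjoint_scaleC scaleC_minus_left)
  \<comment> \<open>The mixed terms in \<open>h\<close> and \<open>k\<close> cancel in the sum, so
    inserting the hypothesis on \<open>adjoint c * c\<close> leaves \<open>c * adjoint c\<close> as
    a sum of squares.\<close>
  have "adjoint c * c + c * adjoint c = 2 *\<^sub>R (h * h) + 2 *\<^sub>R (k * k)"
    unfolding ac unfolding hk(3)
    by (simp add: algebra_simps mult_scaleC_left mult_scaleC_right scaleC_ii_ii
        scaleC_add_right scaleC_diff_right scaleR_2)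
  then have "c * adjoint c = 2 *\<^sub>R (h * h) + 2 *\<^sub>R (k * k) + s * s"
    using cs by (simp add: algebra_simps)
  then have pos: "c * adjoint c \<in> pos_cone"
    using hk s by (simp add: pos_cone_add pos_cone_scaleR square_pos_cone)
  define n where "n = (norm c)\<^sup>2"
  have ncs: "norm (c * adjoint c) = n" using cstar_identity[of "adjoint c"] by (simp add: adjoint_adjoint n_def)
  have nss: "norm (s * s) = n" using cstar_identity[of c] by (simp add: cs n_def)
  have B: "norm (n *\<^sub>R 1 - c * adjoint c) \<le> n" using pos_cone_norm_diff[OF pos] ncs by simp
  define A where "A = n *\<^sub>R 1 + s * s"
  have Asa: "A \<in> self_adjoint"
    unfolding A_def using s by (intro subspace_add subspace_self_adjoint self_adjoint_square) auto
  \<comment> \<open>The lower bound \<open>2 * n <= norm A\<close> comes from the order: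
    \<open>norm A *\<^sub>R 1 - A\<close> lies in the cone, and \<open>A\<close> exceeds
    \<open>s * s\<close> by \<open>n *\<^sub>R 1\<close>.\<close>
  have "norm (s * s) \<le> norm A - n"
  proof (rule pos_cone_norm_le)
    show "s * s \<in> pos_cone" using s by (rule square_pos_cone)
    have "norm A *\<^sub>R 1 - A \<in> pos_cone" using norm_le_imp_diff_pos_cone[OF Asa] by simp
    then show "(norm A - n) *\<^sub>R 1 - s * s \<in> pos_cone" by (simp add: A_def algebra_simps)
  qed
  moreover have "norm A \<le> n + norm (s * s)"
    using norm_triangle_ineq[of "n *\<^sub>R 1" "s * s"] by (simp add: A_def n_def)
  ultimately have nA: "norm A = 2 * n" using nss by simp
  have "A * A = n *\<^sub>R A - adjoint c * (n *\<^sub>R 1 - c * adjoint c) * c"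
  proof -
    have "adjoint c * (c * (adjoint c * c)) = s * s * (s * s)"
      by (metis cs minus_mult_minus mult.assoc)
    then show ?thesis using cs by (simp add: A_def algebra_simps)
  qed
  then have "norm (A * A) \<le> norm (n *\<^sub>R A) + norm (adjoint c * (n *\<^sub>R 1 - c * adjoint c) * c)"
    by (metis norm_triangle_ineq4)
  moreover have "norm (adjoint c * (n *\<^sub>R 1 - c * adjoint c) * c) \<le> norm c * n * norm c"
    using B by (intro norm_mult_ineq[THEN order_trans] mult_mono) (auto simp: n_def)
  moreover have "norm (A * A) = 4 * n\<^sup>2"
    using norm_square_self_adjoint[OF Asa] by (simp add: nA)
  ultimately have "n\<^sup>2 \<le> 0"
    using nA by (simp add: n_def power2_eq_square algebra_simps)
  then show ?thesis by (simp add: n_def)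
qed

text \<open>With \<open>g = (|b| - b)/2\<close>, the negative part of \<open>b = x\<^sup>*x\<close>, the element \<open>c = x g\<close> has \<open>c\<^sup>*c = -g\<^sup>3 \<le> 0\<close>.\<close>

lemma adjoint_mult_self_pos_cone:
  fixes x :: "'a::unital_cstar_algebra"
  shows "adjoint x * x \<in> pos_cone"
proof -
  define b where "b = adjoint x * x"
  have b: "b \<in> self_adjoint" by (simp add: b_def self_adjoint_def adjoint_mult adjoint_adjoint)
  have "b * b \<in> pos_cone" using b by (rule square_pos_cone)
  then obtain m where m: "m \<in> self_adjoint" "m * m = b * b" "m \<in> pos_cone"
      "\<And>c. c * (b * b) = b * b * c \<Longrightarrow> c * m = m * c"
    using pos_cone_sqrt by blast
  \<comment> \<open>Here \<open>m\<close> is the absolute value of \<open>b\<close>; its root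
    \<open>r\<close> turns \<open>g * (m * g)\<close> into the square of the self-adjoint
    \<open>r * g\<close>.\<close>
  obtain r where r: "r \<in> self_adjoint" "r * r = m" "\<And>c. c * m = m * c \<Longrightarrow> c * r = r * c"
    using pos_cone_sqrt[OF m(3)] by blast
  have bm: "b * m = m * b" using m(4)[of b] by (simp add: mult.assoc)
  have br: "b * r = r * b" using r(3) bm by blast
  have mr: "m * r = r * m" using r(3) by blast
  define g where "g = (1/2) *\<^sub>R (m - b)"
  have g: "g \<in> self_adjoint"
    unfolding g_def using m(1) b by (intro subspace_scale subspace_diff subspace_self_adjoint)
  have gb: "g * b = b * g" and gm: "g * m = m * g" and gr: "g * r = r * g"
    using bm br mr by (simp_all add: g_def algebra_simps)
  have "(m + b) * (m - b) = 0"
    using bm m(2) by (simp add: algebra_simps)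
  then have "(m + b) * g = 0" by (simp add: g_def)
  then have mbg: "m * g = - (b * g)"
    by (simp add: distrib_right eq_neg_iff_add_eq_0)
  have "adjoint (x * g) * (x * g) = g * b * g"
    using g by (simp add: b_def self_adjoint_def adjoint_mult mult.assoc)
  also have "\<dots> = - (g * (m * g))"
    by (simp add: mbg mult.assoc)
  also have "g * (m * g) = (r * g) * (r * g)"
    by (metis gr mult.assoc r(2))
  finally have "adjoint (x * g) * (x * g) = - ((r * g) * (r * g))" .
  moreover have "r * g \<in> self_adjoint"
    using r(1) g gr by (simp add: self_adjoint_def adjoint_mult)
  ultimately have "x * g = 0" by (rule adjoint_mult_self_neg_square[rotated])
  then have "b * g = 0" by (simp add: b_def mult.assoc)
  then have "m * g = 0" by (simp add: mbg)
  with \<open>b * g = 0\<close> have "g * g = 0"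
    by (simp add: g_def algebra_simps)
  then have "g = 0" using norm_square_self_adjoint[OF g] by simp
  then have "b = m" by (simp add: g_def)
  then show ?thesis using m(3) by (simp add: b_def)
qed

section \<open>The Hahn-Banach theorem for sublinear functionals\<close>

definition sublinear :: "('a::real_vector \<Rightarrow> real) \<Rightarrow> bool" where
  "sublinear q \<longleftrightarrow> (\<forall>x y. q (x + y) \<le> q x + q y) \<and> (\<forall>c x. c > 0 \<longrightarrow> q (c *\<^sub>R x) = c * q x)"

lemma sublinear_zero: "sublinear q \<Longrightarrow> q 0 = 0"
  unfolding sublinear_def by (metis add_cancel_right_left mult_2 scaleR_zero_right zero_less_numeral)

lemma sublinear_minus: 
  assumes "sublinear q" shows "- q (- x) \<le> q x"
proof -
  have "q (x + - x) \<le> q x + q (- x)" using assms unfolding sublinear_def by blast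
  then show ?thesis using sublinear_zero[OF assms] by simp
qed

text \<open>The infimum of \<open>q (x + t *\<^sub>R y) - t * q y\<close> over nonnegative
  \<open>t\<close> is the largest sublinear functional below \<open>q\<close> whose value at
  \<open>- y\<close> is at most \<open>- q y\<close>; the latter bound is the term with
  \<open>t = 1\<close>.\<close>

lemma sublinear_lower:
  assumes q: "sublinear q"
  obtains q' where "sublinear q'" "\<And>x. q' x \<le> q x" "q' (- y) \<le> - q y"
proof -
  have add: "q (u + v) \<le> q u + q v" and sc: "c > 0 \<Longrightarrow> q (c *\<^sub>R u) = c * q u" for u v c
    using q unfolding sublinear_def by auto
  define S where "S x = (\<lambda>t. q (x + t *\<^sub>R y) - t * q y) ` {0..}" for x
  define q' where "q' x = Inf (S x)" for x
  have ne: "S x \<noteq> {}" for x by (simp add: S_def)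
  have ty: "q (t *\<^sub>R y) = t * q y" if "t \<ge> 0" for t
    using that sc[of t y] sublinear_zero[OF q] by (cases "t = 0") auto
  have bdd: "bdd_below (S x)" for x
  proof (rule bdd_belowI)
    fix s assume "s \<in> S x"
    then obtain t where t: "t \<ge> 0" "s = q (x + t *\<^sub>R y) - t * q y" by (auto simp: S_def)
    show "- q (- x) \<le> s"
      using add[of "x + t *\<^sub>R y" "- x"] ty[OF t(1)] t(2) by (simp add: algebra_simps)
  qed
  have le: "q' x \<le> q (x + t *\<^sub>R y) - t * q y" if "t \<ge> 0" for x t
    unfolding q'_def by (rule cInf_lower[OF _ bdd]) (use that in \<open>auto simp: S_def\<close>)
  have ge: "m \<le> q' x" if "\<And>t. t \<ge> 0 \<Longrightarrow> m \<le> q (x + t *\<^sub>R y) - t * q y" for m x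
    unfolding q'_def by (rule cInf_greatest[OF ne]) (use that in \<open>auto simp: S_def\<close>)
  have "q' (u + v) \<le> q' u + q' v" for u v
  proof -
    have "q' (u + v) - q' v \<le> q' u"
    proof (rule ge)
      fix t :: real assume t: "t \<ge> 0"
      have "q' (u + v) - (q (u + t *\<^sub>R y) - t * q y) \<le> q' v"
      proof (rule ge)
        fix s :: real assume s: "s \<ge> 0"
        show "q' (u + v) - (q (u + t *\<^sub>R y) - t * q y) \<le> q (v + s *\<^sub>R y) - s * q y"
          using le[of "t + s" "u + v"] s t add[of "u + t *\<^sub>R y" "v + s *\<^sub>R y"]
          by (simp add: algebra_simps)
      qed
      then show "q' (u + v) - q' v \<le> q (u + t *\<^sub>R y) - t * q y" by simp
    qed
    then show ?thesis by simp
  qed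
  moreover have "q' (c *\<^sub>R x) = c * q' x" if c: "c > 0" for c x
  proof -
    \<comment> \<open>One inequality for all positive \<open>k\<close> suffices, since its instance
      at \<open>1 / c\<close> gives the converse.\<close>
    have *: "k * q' x \<le> q' (k *\<^sub>R x)" if k: "k > 0" for k x
    proof (rule ge)
      fix t :: real assume t: "t \<ge> 0"
      have "q (k *\<^sub>R (x + (t / k) *\<^sub>R y)) = k * q (x + (t / k) *\<^sub>R y)" using sc k by blast
      moreover have "k *\<^sub>R (x + (t / k) *\<^sub>R y) = k *\<^sub>R x + t *\<^sub>R y" using k by (simp add: algebra_simps)
      moreover have "k * q' x \<le> k * (q (x + (t / k) *\<^sub>R y) - (t / k) * q y)"
        using k t by (intro mult_left_mono le) auto
      ultimately show "k * q' x \<le> q (k *\<^sub>R x + t *\<^sub>R y) - t * q y"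
        using k by (simp add: algebra_simps)
    qed
    have "(1 / c) * q' (c *\<^sub>R x) \<le> q' x" using *[of "1 / c" "c *\<^sub>R x"] c by simp
    then have "q' (c *\<^sub>R x) \<le> c * q' x" using c by (simp add: field_simps)
    with *[OF c, of x] show ?thesis by simp
  qed
  ultimately have "sublinear q'" by (simp add: sublinear_def)
  moreover have "q' x \<le> q x" for x using le[of 0 x] by simp
  moreover have "q' (- y) \<le> - q y" using le[of 1 "- y"] sublinear_zero[OF q] by simp
  ultimately show ?thesis using that by blast
qed

text \<open>A pointwise minimal sublinear functional \<open>m\<close> is odd, because \<open>sublinear_lower\<close> cannot decrease it,
  and an odd sublinear functional is linear.\<close>

lemma Hahn_Banach_sublinear:
  assumes p: "sublinear p"
  obtains f where "linear f" "\<And>x. f x \<le> p x" "f a = p a"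
proof -
  \<comment> \<open>Lowering \<open>p\<close> at \<open>- a\<close> first forces
    \<open>f (- a) <= - p a\<close> for the linear \<open>f\<close> found below \<open>p'\<close>,
    which yields equality at \<open>a\<close>.\<close>
  obtain p' where p': "sublinear p'" "\<And>x. p' x \<le> p x" "p' (- a) \<le> - p a"
    using sublinear_lower[OF p] by blast
  define A where "A = {q. sublinear q \<and> (\<forall>x. q x \<le> p' x)}"
  \<comment> \<open>The order is reversed, so that the maximal element from Zorn's lemma is
    pointwise minimal.\<close>
  define P where "P q r \<longleftrightarrow> (\<forall>x. r x \<le> (q x :: real))" for q r :: "'a \<Rightarrow> real"
  have "\<exists>m\<in>A. \<forall>q\<in>A. P m q \<longrightarrow> q = m"
  proof (rule predicate_Zorn)
    show "partial_order_on A (relation_of P A)"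
      by (rule partial_order_on_relation_ofI) (auto simp: P_def intro: order_trans intro!: ext antisym)
    fix C assume C: "C \<in> Chains (relation_of P A)"
    then have sub: "C \<subseteq> A" and tot: "\<And>q r. q \<in> C \<Longrightarrow> r \<in> C \<Longrightarrow> P q r \<or> P r q"
      unfolding Chains_def relation_of_def by auto
    show "\<exists>u\<in>A. \<forall>q\<in>C. P q u"
    proof (cases "C = {}")
      case True
      then show ?thesis using p' by (auto simp: A_def)
    next
      case False
      define u where "u x = (INF q\<in>C. q x)" for x
      have CA: "sublinear q" "q x \<le> p' x" if "q \<in> C" for q x using that sub by (auto simp: A_def)
      have bdd: "bdd_below ((\<lambda>q. q x) ` C)" for x
      proof (rule bdd_belowI)
        fix s assume "s \<in> (\<lambda>q. q x) ` C"
        then obtain q where "q \<in> C" "s = q x" by blast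
        then show "- p' (- x) \<le> s" using sublinear_minus[OF CA(1), of q x] CA(2)[of q "- x"] by simp
      qed
      have le: "u x \<le> q x" if "q \<in> C" for q x
        unfolding u_def by (rule cINF_lower[OF bdd that])
      have ge: "m \<le> u x" if "\<And>q. q \<in> C \<Longrightarrow> m \<le> q x" for m x
        unfolding u_def by (rule cINF_greatest[OF False that])
      have "u (x + y) \<le> u x + u y" for x y
      proof -
        have "u (x + y) - u y \<le> u x"
        proof (rule ge)
          fix q assume q: "q \<in> C"
          have "u (x + y) - q x \<le> u y"
          proof (rule ge)
            fix r assume r: "r \<in> C"
            \<comment> \<open>In a chain the smaller of \<open>q\<close> and \<open>r\<close> serves
              at both points at once.\<close>
            obtain s where s: "s \<in> C" "s x \<le> q x" "s y \<le> r y"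
              using tot[OF q r] q r unfolding P_def by blast
            have "u (x + y) \<le> s x + s y"
              using le[OF s(1), of "x + y"] CA(1)[OF s(1)] unfolding sublinear_def by (meson order_trans)
            then show "u (x + y) - q x \<le> r y" using s by simp
          qed
          then show "u (x + y) - u y \<le> q x" by simp
        qed
        then show ?thesis by simp
      qed
      moreover have "u (c *\<^sub>R x) = c * u x" if c: "c > 0" for c x
      proof -
        have *: "k * u x \<le> u (k *\<^sub>R x)" if k: "k > 0" for k x
        proof (rule ge)
          fix q assume q: "q \<in> C"
          then have "q (k *\<^sub>R x) = k * q x" using CA k unfolding sublinear_def by blast
          then show "k * u x \<le> q (k *\<^sub>R x)" using le[OF q] k by simp
        qed
        have "(1 / c) * u (c *\<^sub>R x) \<le> u x" using *[of "1 / c" "c *\<^sub>R x"] c by simp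
        then have "u (c *\<^sub>R x) \<le> c * u x" using c by (simp add: field_simps)
        with *[OF c, of x] show ?thesis by simp
      qed
      ultimately have "sublinear u" by (simp add: sublinear_def)
      moreover have "u x \<le> p' x" for x using False le CA by (meson all_not_in_conv order_trans)
      ultimately show ?thesis using le by (auto simp: A_def P_def)
    qed
  qed
  then obtain f where f: "f \<in> A" and min: "\<And>q. q \<in> A \<Longrightarrow> P f q \<Longrightarrow> q = f" by blast
  then have fs: "sublinear f" and fp: "f x \<le> p' x" for x by (auto simp: A_def)
  have odd: "f (- y) = - f y" for y
  proof -
    obtain q where q: "sublinear q" "\<And>x. q x \<le> f x" "q (- y) \<le> - f y"
      using sublinear_lower[OF fs] by blast
    have "q \<in> A" using q(1,2) fp by (auto simp: A_def intro: order_trans)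
    then have "q = f" using min q(2) by (auto simp: P_def)
    then show ?thesis using q(3) sublinear_minus[OF fs, of y] by simp
  qed
  have add: "f (x + y) = f x + f y" for x y
  proof (rule antisym)
    show "f (x + y) \<le> f x + f y" using fs unfolding sublinear_def by blast
    have "f (- x + - y) \<le> f (- x) + f (- y)" using fs unfolding sublinear_def by blast
    then show "f x + f y \<le> f (x + y)" using odd[of "x + y"] by (simp add: odd)
  qed
  have "f (c *\<^sub>R x) = c * f x" for c x
  proof (cases c "0::real" rule: linorder_cases)
    case less
    then have "f ((- c) *\<^sub>R x) = - c * f x" using fs unfolding sublinear_def by (metis neg_0_less_iff_less)
    then show ?thesis using odd[of "c *\<^sub>R x"] by simp
  qed (use fs sublinear_zero[OF fs] in \<open>auto simp: sublinear_def\<close>)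
  then have "linear f" using add by (intro linearI) auto
  moreover have "f x \<le> p x" for x using fp p'(2) order_trans by blast
  moreover have "f a = p a"
    using odd[of a] fp[of "- a"] p'(3) calculation(2)[of a] by simp
  ultimately show ?thesis using that by blast
qed

section \<open>States\<close>

text \<open>A state is nonnegative on the cone, since a cone element is \<open>adjoint y * y\<close>
  for its self-adjoint root \<open>y\<close>. Applied to \<open>norm a *\<^sub>R 1 - a\<close> and
  \<open>norm a *\<^sub>R 1 + a\<close>, this makes the value at \<open>a\<close> real and bounds
  it.\<close>

lemma states_self_adjoint:
  assumes \<phi>: "\<phi> \<in> states" and a: "a \<in> self_adjoint"
  shows "\<phi> a \<in> \<real>" "cmod (\<phi> a) \<le> norm a"
proof -
  have add: "\<phi> (x + y) = \<phi> x + \<phi> y" and sc: "\<phi> (c *\<^sub>C x) = c * \<phi> x"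
    and ps: "\<phi> (adjoint x * x) \<in> \<real>\<^sub>\<ge>\<^sub>0" and one: "\<phi> 1 = 1" for x y c
    using \<phi> by (auto simp: states_def)
  have pos: "\<phi> x \<in> \<real>\<^sub>\<ge>\<^sub>0" if x: "x \<in> pos_cone" for x
  proof -
    obtain y where "y \<in> self_adjoint" "y * y = x" using pos_cone_sqrt[OF x] by blast
    then show ?thesis using ps[of y] by (simp add: self_adjoint_def)
  qed
  have t: "\<phi> (norm a *\<^sub>R 1) = norm a" using sc[of "of_real (norm a)" 1] one by (simp add: scaleC_of_real)
  have "\<phi> (norm a *\<^sub>R 1 - a) + \<phi> a = norm a" using add[of "norm a *\<^sub>R 1 - a" a] t by simp
  moreover have "\<phi> (norm a *\<^sub>R 1 - a) \<in> \<real>\<^sub>\<ge>\<^sub>0"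
    using a by (intro pos norm_le_imp_diff_pos_cone) auto
  moreover have "\<phi> (norm a *\<^sub>R 1 + a) = norm a + \<phi> a" using add[of "norm a *\<^sub>R 1" a] t by simp
  moreover have "\<phi> (norm a *\<^sub>R 1 - (- a)) \<in> \<real>\<^sub>\<ge>\<^sub>0"
    using a subspace_neg[OF subspace_self_adjoint] by (intro pos norm_le_imp_diff_pos_cone) auto
  ultimately have "\<phi> a = complex_of_real (Re (\<phi> a)) \<and> \<bar>Re (\<phi> a)\<bar> \<le> norm a"
    by (auto simp: complex_nonneg_Reals_iff complex_eq_iff abs_le_iff)
  then show "\<phi> a \<in> \<real>" "cmod (\<phi> a) \<le> norm a"
    by (metis Reals_of_real, metis norm_of_real)
qed

lemma states_norm_le:
  assumes \<phi>: "\<phi> \<in> states"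
  shows "cmod (\<phi> x) \<le> 2 * norm x"
proof -
  obtain h k where hk: "h \<in> self_adjoint" "k \<in> self_adjoint" "x = h + \<i> *\<^sub>C k"
    "norm h \<le> norm x" "norm k \<le> norm x"
    using real_part_decomposition by blast
  have "\<phi> x = \<phi> h + \<i> * \<phi> k" using \<phi> hk(3) by (simp add: states_def)
  then have "cmod (\<phi> x) \<le> cmod (\<phi> h) + cmod (\<phi> k)"
    using norm_triangle_ineq[of "\<phi> h" "\<i> * \<phi> k"] by (simp add: norm_mult)
  then show ?thesis
    using states_self_adjoint(2)[OF \<phi> hk(1)] states_self_adjoint(2)[OF \<phi> hk(2)] hk(4,5) by linarith
qed

text \<open>The Banach-Alaoglu argument: by Tychonoff the product of the discs of radius
  \<open>2 * norm x\<close> is compact, and the conditions defining a state are closed under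
  pointwise limits.\<close>

lemma compact_space_weak_star_states: "compact_space (weak_star_states :: ('a::unital_cstar_algebra \<Rightarrow> complex) topology)"
proof -
  let ?K = "PiE UNIV (\<lambda>x::'a. cball (0::complex) (2 * norm x))"
  have "compactin (product_topology (\<lambda>_::'a. euclidean) UNIV) ?K"
    by (subst compactin_PiE) auto
  then have K: "compact ?K" by (simp add: euclidean_product_topology)
  have cl: "closed (states :: ('a \<Rightarrow> complex) set)"
  proof -
    have c: "continuous_on UNIV (\<lambda>\<phi> :: 'a \<Rightarrow> complex. \<phi> x)" for x by (rule continuous_on_product_coordinates)
    have "closed {\<phi> :: 'a \<Rightarrow> complex. \<phi> (adjoint x * x) \<in> \<real>\<^sub>\<ge>\<^sub>0}" for x
      using closed_vimage[OF closed_nonneg_Reals_complex c] by (simp add: vimage_def)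
    then show ?thesis
      unfolding states_def
      by (intro closed_Collect_conj closed_Collect_all closed_Collect_eq continuous_on_add
          continuous_on_mult continuous_on_const c)
  qed
  have "(states :: ('a \<Rightarrow> complex) set) \<subseteq> ?K" using states_norm_le by auto
  then have "compact (states :: ('a \<Rightarrow> complex) set)"
    using K cl by (metis compact_Int_closed inf.absorb2)
  then show ?thesis
    unfolding weak_star_states_def by (intro compact_space_subtopology) (simp add: euclidean_product_topology)
qed

text \<open>On self-adjoint elements this is the top of the spectrum, expressed through the order.
  Passing through the real part extends it to the whole real vector space, where the Hahn-Banach
  theorem is applied.\<close>

definition upper_bound :: "'a::unital_cstar_algebra \<Rightarrow> real" where
  "upper_bound x = Inf {t. t *\<^sub>R 1 - (1/2) *\<^sub>R (x + adjoint x) \<in> pos_cone}"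

lemma real_part_self_adjoint: "(1/2) *\<^sub>R (x + adjoint x) \<in> self_adjoint"
  by (simp add: self_adjoint_def adjoint_add adjoint_scaleR adjoint_adjoint add.commute)

lemma upper_bound_set_nonempty:
  "{t. t *\<^sub>R 1 - (1/2) *\<^sub>R (x + adjoint x) \<in> pos_cone} \<noteq> {}"
  using norm_le_imp_diff_pos_cone[OF real_part_self_adjoint order_refl] by blast

lemma upper_bound_le:
  assumes "t *\<^sub>R 1 - (1/2) *\<^sub>R (x + adjoint x) \<in> pos_cone"
  shows "upper_bound x \<le> t"
  unfolding upper_bound_def
proof (rule cInf_lower)
  define h where "h = (1/2) *\<^sub>R (x + adjoint x)"
  have h: "- h \<in> self_adjoint" unfolding h_def
    by (intro subspace_neg subspace_self_adjoint real_part_self_adjoint)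
  show "bdd_below {t. t *\<^sub>R 1 - (1/2) *\<^sub>R (x + adjoint x) \<in> pos_cone}"
  proof (rule bdd_belowI)
    fix s assume "s \<in> {t. t *\<^sub>R 1 - (1/2) *\<^sub>R (x + adjoint x) \<in> pos_cone}"
    then have "s *\<^sub>R 1 - h \<in> pos_cone" by (simp add: h_def)
    moreover have "norm h *\<^sub>R 1 - - h \<in> pos_cone"
      using h by (rule norm_le_imp_diff_pos_cone) simp
    ultimately have "(s + norm h) *\<^sub>R (1::'a) \<in> pos_cone"
      using pos_cone_add by (fastforce simp: algebra_simps)
    then show "- norm h \<le> s" by (simp add: scaleR_one_pos_cone_iff)
  qed
qed (use assms in simp)

lemma upper_bound_greatest:
  assumes "\<And>t. t *\<^sub>R 1 - (1/2) *\<^sub>R (x + adjoint x) \<in> pos_cone \<Longrightarrow> m \<le> t"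
  shows "m \<le> upper_bound x"
  unfolding upper_bound_def by (rule cInf_greatest[OF upper_bound_set_nonempty]) (use assms in auto)

lemma sublinear_upper_bound: "sublinear (upper_bound :: 'a::unital_cstar_algebra \<Rightarrow> real)"
proof -
  have "upper_bound (x + y) \<le> upper_bound x + upper_bound y" for x y :: 'a
  proof -
    have "upper_bound (x + y) - upper_bound y \<le> upper_bound x"
    proof (rule upper_bound_greatest)
      fix t assume t: "t *\<^sub>R 1 - (1/2) *\<^sub>R (x + adjoint x) \<in> pos_cone"
      have "upper_bound (x + y) - t \<le> upper_bound y"
      proof (rule upper_bound_greatest)
        fix s assume s: "s *\<^sub>R 1 - (1/2) *\<^sub>R (y + adjoint y) \<in> pos_cone"
        have "upper_bound (x + y) \<le> t + s"
          using pos_cone_add[OF t s] by (intro upper_bound_le) (simp add: adjoint_add algebra_simps)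
        then show "upper_bound (x + y) - t \<le> s" by simp
      qed
      then show "upper_bound (x + y) - upper_bound y \<le> t" by simp
    qed
    then show ?thesis by simp
  qed
  moreover have "upper_bound (c *\<^sub>R x) = c * upper_bound x" if c: "c > 0" for c and x :: 'a
  proof -
    have *: "upper_bound (k *\<^sub>R u) \<le> k * upper_bound u" if k: "k > 0" for k and u :: 'a
    proof -
      have "upper_bound (k *\<^sub>R u) / k \<le> upper_bound u"
      proof (rule upper_bound_greatest)
        fix t assume t: "t *\<^sub>R 1 - (1/2) *\<^sub>R (u + adjoint u) \<in> pos_cone"
        have "upper_bound (k *\<^sub>R u) \<le> k * t"
          using pos_cone_scaleR[OF t, of k] k
          by (intro upper_bound_le) (simp add: adjoint_scaleR algebra_simps)
        then show "upper_bound (k *\<^sub>R u) / k \<le> t" using k by (simp add: field_simps)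
      qed
      then show ?thesis using k by (simp add: field_simps)
    qed
    have "upper_bound x \<le> (1 / c) * upper_bound (c *\<^sub>R x)" using *[of "1 / c" "c *\<^sub>R x"] c by simp
    then show ?thesis using *[OF c, of x] c by (simp add: field_simps)
  qed
  ultimately show ?thesis by (simp add: sublinear_def)
qed

text \<open>Any \<open>t\<close> above both upper bounds puts \<open>t *\<^sub>R 1 - a\<close> and
  \<open>t *\<^sub>R 1 + a\<close> in the cone, which bounds the norm by \<open>2 * t\<close>. The
  slack \<open>e\<close> is there because attainment of the infimum is not established.\<close>

lemma norm_le_upper_bound:
  fixes a :: "'a::unital_cstar_algebra"
  assumes a: "a \<in> self_adjoint"
  shows "norm a \<le> 2 * max (upper_bound a) (upper_bound (- a))"
proof (rule field_le_epsilon)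
  have pos: "t *\<^sub>R 1 - x \<in> pos_cone" if x: "x \<in> self_adjoint" and t: "upper_bound x < t" for x :: 'a and t
  proof -
    have "\<exists>s. s *\<^sub>R 1 - (1/2) *\<^sub>R (x + adjoint x) \<in> pos_cone \<and> s < t"
      using upper_bound_greatest[of x t] t by force
    then obtain s where s: "s < t" "s *\<^sub>R 1 - x \<in> pos_cone"
      using x by (auto simp: self_adjoint_def simp flip: scaleR_2)
    have "(t - s) *\<^sub>R 1 + (s *\<^sub>R 1 - x) \<in> pos_cone"
      using s by (intro pos_cone_add) (simp_all add: scaleR_one_pos_cone_iff)
    then show ?thesis by (simp add: algebra_simps)
  qed
  fix e :: real assume e: "e > 0"
  define t where "t = max (upper_bound a) (upper_bound (- a)) + e / 2"
  have "t *\<^sub>R 1 - a \<in> pos_cone" "t *\<^sub>R 1 - - a \<in> pos_cone"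
    using e a subspace_neg[OF subspace_self_adjoint a] by (intro pos; simp add: t_def)+
  then have "norm a \<le> 2 * t" by (intro norm_le_of_pos_cone) auto
  then show "norm a \<le> 2 * max (upper_bound a) (upper_bound (- a)) + e" by (simp add: t_def)
qed

text \<open>Hahn-Banach gives a real functional below \<open>upper_bound\<close> that attains it at
  \<open>a\<close> or \<open>- a\<close>, whichever has the larger upper bound. Domination makes the
  functional positive and unital, and complexification turns it into a state.\<close>

lemma state_exists:
  fixes a :: "'a::unital_cstar_algebra"
  assumes a: "a \<in> self_adjoint"
  obtains \<phi> where "\<phi> \<in> states" "norm a \<le> 2 * cmod (\<phi> a)"
proof -
  define y where "y = (if upper_bound (- a) \<le> upper_bound a then a else - a)"
  have y: "norm a \<le> 2 * upper_bound y" using norm_le_upper_bound[OF a] by (auto simp: y_def max_def split: if_splits)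
  obtain f where f: "linear f" "\<And>x::'a. f x \<le> upper_bound x" "f y = upper_bound y"
    using Hahn_Banach_sublinear[OF sublinear_upper_bound] by blast
  \<comment> \<open>Composition with the real part makes \<open>F\<close> vanish on
    \<open>\<i> *\<^sub>C u\<close> for self-adjoint \<open>u\<close>, so that \<open>\<phi>\<close>
    below is real on self-adjoint elements.\<close>
  define F where "F x = f ((1/2) *\<^sub>R (x + adjoint x))" for x
  have F_add: "F (u + v) = F u + F v" for u v
    unfolding F_def by (simp add: adjoint_add algebra_simps flip: linear_add[OF f(1)])
  have F_scale: "F (r *\<^sub>R u) = r * F u" for r u
  proof -
    have "(1/2) *\<^sub>R (r *\<^sub>R u + adjoint (r *\<^sub>R u)) = r *\<^sub>R (1/2) *\<^sub>R (u + adjoint u)"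
      by (simp add: adjoint_scaleR algebra_simps)
    then show ?thesis unfolding F_def by (metis linear_scale[OF f(1)] real_scaleR_def)
  qed
  have F_minus: "F (- u) = - F u" for u using F_scale[of "-1" u] by simp
  have F_sa: "F u = f u" if "u \<in> self_adjoint" for u
    using that by (simp add: F_def self_adjoint_def flip: scaleR_2)
  have F_sa_ii: "F (\<i> *\<^sub>C u) = 0" if "u \<in> self_adjoint" for u
    using that by (simp add: F_def self_adjoint_def adjoint_scaleC scaleC_minus_left linear_0[OF f(1)])
  \<comment> \<open>The standard extension of a real functional to a complex linear one.\<close>
  define \<phi> where "\<phi> x = Complex (F x) (- F (\<i> *\<^sub>C x))" for x
  have \<phi>_sa: "\<phi> u = of_real (f u)" if "u \<in> self_adjoint" for u
    by (simp add: \<phi>_def F_sa F_sa_ii that complex_of_real_def)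
  have f_pos: "f u \<ge> 0" if u: "u \<in> pos_cone" for u
  proof -
    have "upper_bound (- u) \<le> 0"
      using u pos_cone_self_adjoint[OF u]
      by (intro upper_bound_le) (simp add: self_adjoint_def adjoint_minus flip: scaleR_2)
    then show ?thesis using f(2)[of "- u"] linear_neg[OF f(1), of u] by simp
  qed
  have "f 1 = 1"
  proof -
    have "upper_bound (1::'a) \<le> 1" "upper_bound (- 1::'a) \<le> - 1"
      using scaleR_one_pos_cone_iff[of 0, where 'a = 'a]
      by (auto intro!: upper_bound_le simp: adjoint_minus simp flip: scaleR_2)
    then show ?thesis using f(2)[of 1] f(2)[of "- 1"] linear_neg[OF f(1), of 1] by simp
  qed
  have split: "c *\<^sub>C u = Re c *\<^sub>R u + Im c *\<^sub>R (\<i> *\<^sub>C u)" for c u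
    by (metis complex_eq mult.commute scaleC_add_left scaleC_of_real scaleC_scaleC)
  have "\<phi> (u + v) = \<phi> u + \<phi> v" for u v
    by (simp add: \<phi>_def F_add scaleC_add_right complex_eq_iff)
  moreover have "\<phi> (c *\<^sub>C u) = c * \<phi> u" for c u
  proof -
    have "\<i> *\<^sub>C c *\<^sub>C u = Re c *\<^sub>R (\<i> *\<^sub>C u) + Im c *\<^sub>R (- u)"
      by (subst split[of c]) (simp add: scaleC_add_right scaleC_scaleR scaleC_ii_ii del: scaleR_minus_right)
    then have "F (\<i> *\<^sub>C c *\<^sub>C u) = Re c * F (\<i> *\<^sub>C u) - Im c * F u"
      by (simp add: F_add F_scale F_minus del: scaleR_minus_right)
    moreover have "F (c *\<^sub>C u) = Re c * F u + Im c * F (\<i> *\<^sub>C u)"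
      by (subst split) (simp only: F_add F_scale)
    ultimately show ?thesis by (simp add: \<phi>_def complex_eq_iff)
  qed
  moreover have "\<phi> (adjoint u * u) \<in> \<real>\<^sub>\<ge>\<^sub>0" for u
    using f_pos[OF adjoint_mult_self_pos_cone[of u]] \<phi>_sa[OF pos_cone_self_adjoint[OF adjoint_mult_self_pos_cone[of u]]]
    by (simp add: complex_nonneg_Reals_iff)
  moreover have "\<phi> 1 = 1" using \<open>f 1 = 1\<close> by (simp add: \<phi>_sa)
  ultimately have "\<phi> \<in> states" by (simp add: states_def)
  moreover have "cmod (\<phi> a) = \<bar>f y\<bar>"
    using a by (simp add: \<phi>_sa y_def linear_neg[OF f(1)])
  then have "norm a \<le> 2 * cmod (\<phi> a)" using y f(3) by simp
  ultimately show ?thesis using that by blast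
qed

section \<open>Star automorphisms\<close>

lemma star_automorphism_one:
  assumes "star_automorphism \<alpha>" shows "\<alpha> 1 = 1"
proof -
  obtain e where "\<alpha> e = 1" using assms unfolding star_automorphism_def by (metis bij_pointE)
  then show ?thesis using assms unfolding star_automorphism_def by (metis mult_1_left mult_1_right)
qed

lemma star_automorphism_scaleR:
  "star_automorphism \<alpha> \<Longrightarrow> \<alpha> (r *\<^sub>R x) = r *\<^sub>R \<alpha> x"
  unfolding star_automorphism_def by (metis scaleC_of_real)

lemma star_automorphism_self_adjoint_iff:
  "star_automorphism \<alpha> \<Longrightarrow> \<alpha> x \<in> self_adjoint \<longleftrightarrow> x \<in> self_adjoint"
  unfolding star_automorphism_def self_adjoint_def by (metis (mono_tags, lifting) bij_is_inj injD mem_Collect_eq)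

lemma star_automorphism_inv:
  assumes "star_automorphism \<alpha>" shows "star_automorphism (inv \<alpha>)"
proof -
  have b: "bij \<alpha>" using assms by (simp add: star_automorphism_def)
  then have inv: "\<alpha> (inv \<alpha> x) = x" "inv \<alpha> (\<alpha> x) = x" for x
    by (simp_all add: bij_is_surj surj_f_inv_f bij_is_inj)
  have eqI: "inv \<alpha> x = y" if "x = \<alpha> y" for x y using that inv by simp
  show ?thesis
    using assms bij_imp_bij_inv[OF b] inv unfolding star_automorphism_def
    by (auto intro!: eqI)
qed

lemma star_automorphism_pos_cone:
  assumes \<alpha>: "star_automorphism \<alpha>" and x: "x \<in> pos_cone" shows "\<alpha> x \<in> pos_cone"
proof -
  obtain y where y: "y \<in> self_adjoint" "y * y = x" using pos_cone_sqrt[OF x] by blast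
  then have "\<alpha> x = \<alpha> y * \<alpha> y" using \<alpha> by (auto simp: star_automorphism_def)
  moreover have "\<alpha> y \<in> self_adjoint" using \<alpha> y(1) by (simp add: star_automorphism_self_adjoint_iff)
  ultimately show ?thesis using square_pos_cone(1) by simp
qed

lemma linear_star_automorphism: "star_automorphism \<alpha> \<Longrightarrow> linear \<alpha>"
  by (intro linearI star_automorphism_scaleR) (auto simp: star_automorphism_def)

text \<open>Squares map to squares, so \<alpha> preserves the cone and fixes 1. Order bounds on
  self-adjoint elements therefore carry over up to a factor 2, and the two self-adjoint parts of
  \<open>x\<close> give 4. Only continuity is used later, so the constant is immaterial.\<close>

lemma bounded_linear_star_automorphism:
  assumes \<alpha>: "star_automorphism \<alpha>" shows "bounded_linear \<alpha>"
proof (rule bounded_linear_intro)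
  note lin = linear_star_automorphism[OF \<alpha>]
  show "\<alpha> (x + y) = \<alpha> x + \<alpha> y" "\<alpha> (r *\<^sub>R x) = r *\<^sub>R \<alpha> x" for x y r
    using lin by (auto simp: linear_add linear_scale)
  have sa: "norm (\<alpha> a) \<le> 2 * norm a" if a: "a \<in> self_adjoint" for a
  proof (rule norm_le_of_pos_cone)
    have "norm a *\<^sub>R 1 - a \<in> pos_cone" using norm_le_imp_diff_pos_cone[OF a] by simp
    then have "\<alpha> (norm a *\<^sub>R 1 - a) \<in> pos_cone" by (rule star_automorphism_pos_cone[OF \<alpha>])
    then show "norm a *\<^sub>R 1 - \<alpha> a \<in> pos_cone"
      by (simp add: linear_diff[OF lin] linear_scale[OF lin] star_automorphism_one[OF \<alpha>])
    have "norm a *\<^sub>R 1 - - a \<in> pos_cone"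
      using norm_le_imp_diff_pos_cone[OF subspace_neg[OF subspace_self_adjoint a]] by simp
    then have "\<alpha> (norm a *\<^sub>R 1 - - a) \<in> pos_cone" by (rule star_automorphism_pos_cone[OF \<alpha>])
    then show "norm a *\<^sub>R 1 + \<alpha> a \<in> pos_cone"
      by (simp add: linear_add[OF lin] linear_scale[OF lin] star_automorphism_one[OF \<alpha>])
  qed
  show "norm (\<alpha> x) \<le> norm x * 4" for x
  proof -
    obtain h k where hk: "h \<in> self_adjoint" "k \<in> self_adjoint" "x = h + \<i> *\<^sub>C k"
        "norm h \<le> norm x" "norm k \<le> norm x"
      using real_part_decomposition by blast
    have "\<alpha> x = \<alpha> h + \<i> *\<^sub>C \<alpha> k" using \<alpha> hk(3) by (simp add: star_automorphism_def)
    then have "norm (\<alpha> x) \<le> norm (\<alpha> h) + norm (\<alpha> k)"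
      using norm_triangle_ineq[of "\<alpha> h" "\<i> *\<^sub>C \<alpha> k"] by (simp add: norm_scaleC)
    then show ?thesis using sa[OF hk(1)] sa[OF hk(2)] hk(4,5) by linarith
  qed
qed

section \<open>Lip-norms\<close>

text \<open>The state space is weak* compact, hence bounded for \<open>mk_dist L\<close>, say by
  \<open>B\<close>. With \<open>t\<close> the value at \<open>a\<close> of a fixed state, a state
  detecting the norm of \<open>a - t *\<^sub>R 1\<close> up to the factor 2 bounds that norm by
  \<open>2 * B\<close>.\<close>

lemma lip_dom_radius:
  fixes L :: "'a::unital_cstar_algebra \<Rightarrow> ennreal"
  assumes "quantum_compact_metric_space L"
  obtains R where "R \<ge> 1" "\<And>a. a \<in> lip_dom L \<Longrightarrow> L a \<le> 1 \<Longrightarrow> \<exists>t::real. norm (a - t *\<^sub>R 1) \<le> R"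
proof -
  define d where "d = (\<lambda>\<phi> \<psi>. enn2real (mk_dist L \<phi> \<psi>))"
  have mk: "\<And>\<phi> \<psi>. \<phi> \<in> states \<Longrightarrow> \<psi> \<in> states \<Longrightarrow> mk_dist L \<phi> \<psi> < \<infinity>"
    "Metric_space states d" "Metric_space.mtopology states d = weak_star_states"
    using assms by (auto simp: quantum_compact_metric_space_def mk_metrizes_weak_star_def d_def)
  interpret Metric_space states d by (rule mk(2))
  have "compactin mtopology states"
    using compact_space_weak_star_states mk(3) by (metis compact_space_def topspace_mtopology)
  then obtain B where B: "\<And>\<phi> \<psi>. \<phi> \<in> states \<Longrightarrow> \<psi> \<in> states \<Longrightarrow> d \<phi> \<psi> \<le> B"
    using compactin_imp_mbounded mbounded_alt by metis
  obtain \<psi> :: "'a \<Rightarrow> complex" where \<psi>: "\<psi> \<in> states" using state_exists[OF one_self_adjoint] by blast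
  have "\<exists>t::real. norm (a - t *\<^sub>R 1) \<le> max 1 (2 * B)" if a: "a \<in> lip_dom L" "L a \<le> 1" for a
  proof -
    have sa: "a \<in> self_adjoint" using a by (simp add: lip_dom_def)
    obtain t where t: "\<psi> a = complex_of_real t" using states_self_adjoint(1)[OF \<psi> sa] Reals_cases by metis
    have "a - t *\<^sub>R 1 \<in> self_adjoint" using sa by (intro subspace_diff subspace_self_adjoint) auto
    then obtain \<phi> where \<phi>: "\<phi> \<in> states" "norm (a - t *\<^sub>R 1) \<le> 2 * cmod (\<phi> (a - t *\<^sub>R 1))"
      using state_exists by blast
    have "\<phi> (a - t *\<^sub>R 1 + t *\<^sub>R 1) = \<phi> (a - t *\<^sub>R 1) + \<phi> (t *\<^sub>R 1)"
      using \<phi>(1) unfolding states_def by blast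
    then have "\<phi> a = \<phi> (a - t *\<^sub>R 1) + \<phi> (complex_of_real t *\<^sub>C 1)"
      by (simp add: scaleC_of_real)
    also have "\<phi> (complex_of_real t *\<^sub>C 1) = \<psi> a"
      using \<phi>(1) t unfolding states_def by simp
    finally have "ennreal (cmod (\<phi> (a - t *\<^sub>R 1))) = ennreal (cmod (\<phi> a - \<psi> a))" by simp
    also have "\<dots> \<le> mk_dist L \<phi> \<psi>" unfolding mk_dist_def by (rule SUP_upper) (use a in simp)
    also have "\<dots> = ennreal (d \<phi> \<psi>)" using mk(1)[OF \<phi>(1) \<psi>] by (simp add: d_def)
    also have "\<dots> \<le> ennreal B" using B[OF \<phi>(1) \<psi>] by (rule ennreal_leI)
    \<comment> \<open>Leaving \<open>ennreal\<close> requires \<open>B\<close> to be nonnegative,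
      which follows from \<open>d \<psi> \<psi> \<le> B\<close>.\<close>
    finally have "cmod (\<phi> (a - t *\<^sub>R 1)) \<le> B"
      using order_trans[OF nonneg B[OF \<psi> \<psi>]] by (simp add: ennreal_le_iff)
    then show ?thesis using \<phi>(2) by (intro exI[of _ t]) simp
  qed
  then show ?thesis using that[of "max 1 (2 * B)"] by simp
qed

text \<open>Baire's theorem is applied in \<open>B\<close> itself, completely metrizable as a closed
  subset of a Banach space. The interior is relative to \<open>B\<close>, which may have empty
  interior in the whole space.\<close>

lemma closed_cover_contains_ball:
  fixes B :: "'a::banach set"
  assumes B: "closed B" "B \<noteq> {}" and cl: "\<And>n::nat. closed (T n)" and cover: "B \<subseteq> (\<Union>n. T n)"
  obtains n a r where "a \<in> B" "r > 0" "ball a r \<inter> B \<subseteq> T n"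
proof -
  let ?X = "top_of_set B"
  have X: "completely_metrizable_space ?X"
    using B(1) by (intro completely_metrizable_space_closedin completely_metrizable_space_euclidean) auto
  have "\<exists>n. ?X interior_of (B \<inter> T n) \<noteq> {}"
  proof (rule ccontr)
    assume "\<not> (\<exists>n. ?X interior_of (B \<inter> T n) \<noteq> {})"
    moreover have "closedin ?X (B \<inter> T n)" for n using cl by (rule closedin_closed_Int)
    ultimately have "?X interior_of (\<Union>(range (\<lambda>n. B \<inter> T n))) = {}"
      using X by (intro Baire_category_alt) auto
    moreover have "\<Union>(range (\<lambda>n. B \<inter> T n)) = topspace ?X" using cover by auto
    ultimately show False using B(2) by (metis interior_of_topspace topspace_euclidean_subtopology)
  qed
  then obtain n a where "a \<in> ?X interior_of (B \<inter> T n)" by blast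
  then obtain V where V: "openin ?X V" "a \<in> V" "V \<subseteq> B \<inter> T n" by (auto simp: interior_of_def)
  then obtain U where U: "open U" "V = B \<inter> U" by (auto simp: openin_open)
  then obtain r where "r > 0" "ball a r \<subseteq> U" using V(2) open_contains_ball by blast
  then show ?thesis using that[of a r n] V U by blast
qed

text \<open>Baire bounds \<open>L\<close> after \<alpha> near one point of the convex set
  \<open>B\<close>; convexity spreads the bound to all of \<open>B\<close>, and
  \<open>lip_dom_radius\<close> with homogeneity spreads it to the domain. This is one half of the
  comparison, the other being its instance for the inverse.\<close>

lemma lip_dom_invariant_imp_bound:
  fixes L :: "'a::unital_cstar_algebra \<Rightarrow> ennreal"
  assumes L: "quantum_compact_metric_space L" and lsc: "lip_lower_semicontinuous L"
    and \<alpha>: "star_automorphism \<alpha>" and inv: "\<alpha> ` lip_dom L \<subseteq> lip_dom L"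
  obtains C where "C > 0" "\<And>a. a \<in> self_adjoint \<Longrightarrow> L (\<alpha> a) \<le> ennreal C * L a"
proof -
  define D where "D = lip_dom L"
  \<comment> \<open>On \<open>D\<close> the value of \<open>L\<close> is finite, so passing to reals
    loses nothing there.\<close>
  define q where "q a = enn2real (L a)" for a
  note lin = linear_star_automorphism[OF \<alpha>]
  have Lq: "L a = ennreal (q a)" if "a \<in> D" for a
    using that by (simp add: D_def lip_dom_def q_def)
  have q0: "q a \<ge> 0" for a by (simp add: q_def)
  have \<alpha>D: "\<alpha> a \<in> D" if "a \<in> D" for a
    using inv that by (auto simp: D_def)
  have subD: "subspace D" using L by (simp add: quantum_compact_metric_space_def D_def)
  have add: "q (a + b) \<le> q a + q b" if "a \<in> D" "b \<in> D" for a b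
  proof -
    have "L (a + b) \<le> L a + L b" using L that by (simp add: quantum_compact_metric_space_def D_def)
    then show ?thesis using that subspace_add[OF subD that] q0
      by (simp add: Lq ennreal_le_iff flip: ennreal_plus)
  qed
  have scale: "q (t *\<^sub>R a) = \<bar>t\<bar> * q a" if "a \<in> D" for t a
  proof -
    have "L (t *\<^sub>R a) = ennreal \<bar>t\<bar> * L a" using L that by (simp add: quantum_compact_metric_space_def D_def)
    then show ?thesis by (simp add: q_def enn2real_mult)
  qed
  have null: "a \<in> D \<and> q a = 0 \<longleftrightarrow> (\<exists>t. a = t *\<^sub>R 1)" for a
  proof -
    have "{a \<in> D. L a = 0} = range (\<lambda>t::real. t *\<^sub>R 1)"
      using L by (simp add: quantum_compact_metric_space_def D_def)
    moreover have "a \<in> D \<and> L a = 0 \<longleftrightarrow> a \<in> D \<and> q a = 0" by (metis Lq q_def ennreal_0 enn2real_0)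
    ultimately show ?thesis by blast
  qed
  define S where "S = {a \<in> D. q a \<le> 1}"
  have "S = {a \<in> lip_dom L. L a \<le> 1}" by (auto simp: S_def D_def[symmetric] Lq)
  then have "closed S"
    using lsc closedin_closed_trans[OF _ closed_self_adjoint] by (simp add: lip_lower_semicontinuous_def)
  \<comment> \<open>The cut with the unit ball makes \<open>B\<close> bounded, so that a strong
    enough contraction towards one of its points moves all of \<open>B\<close> into a small
    ball.\<close>
  define B where "B = S \<inter> cball 0 1"
  have "closed B" unfolding B_def using \<open>closed S\<close> by blast
  have "0 \<in> B" using null[of 0] by (auto simp: B_def S_def)
  \<comment> \<open>On \<open>D\<close> this is a sublevel set of \<open>q\<close> after \<alpha>;
    as a preimage of \<open>S\<close> it is closed by continuity of \<alpha>. \<open>Suc\<close>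
    avoids division by zero.\<close>
  define T where "T n = (\<lambda>a. (1 / real (Suc n)) *\<^sub>R \<alpha> a) -` S" for n
  have T_iff: "a \<in> T n \<longleftrightarrow> q (\<alpha> a) \<le> real (Suc n)" if "a \<in> D" for a n
    using \<alpha>D[OF that] subspace_scale[OF subD \<alpha>D[OF that]] by (simp add: T_def S_def scale divide_le_eq)
  have T_closed: "closed (T n)" for n
    unfolding T_def using \<open>closed S\<close>
    by (intro closed_vimage linear_continuous_on bounded_linear_compose[OF bounded_linear_scaleR_right]
        bounded_linear_star_automorphism \<alpha>)
  have T_cover: "B \<subseteq> (\<Union>n. T n)"
  proof
    fix a assume "a \<in> B"
    then have a: "a \<in> D" by (simp add: B_def S_def)
    obtain n where "q (\<alpha> a) \<le> real n" using real_arch_simple by blast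
    then have "a \<in> T n" using T_iff[OF a] by simp
    then show "a \<in> (\<Union>n. T n)" by blast
  qed
  have "B \<noteq> {}" using \<open>0 \<in> B\<close> by blast
  obtain n a0 r where a0: "a0 \<in> B" and r: "r > 0" and ball: "ball a0 r \<inter> B \<subseteq> T n"
    by (rule closed_cover_contains_ball[OF \<open>closed B\<close> \<open>B \<noteq> {}\<close> T_closed T_cover])
  define k where "k = real (Suc n)"
  \<comment> \<open>Points of \<open>B\<close> are at most 2 apart, so contraction by
    \<open>s\<close> stays within \<open>2 * s < r\<close> of \<open>a0\<close>.\<close>
  define s where "s = min 1 (r / 4)"
  have s: "0 < s" "s \<le> 1" "2 * s < r" using r by (auto simp: s_def)
  have a0D: "a0 \<in> D" using a0 by (simp add: B_def S_def)
  have "a0 \<in> T n" using ball a0 r by auto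
  then have qa0: "q (\<alpha> a0) \<le> k" using T_iff[OF a0D] by (simp add: k_def)
  have qB: "q (\<alpha> b) \<le> 2 * k / s" if b: "b \<in> B" for b
  proof -
    \<comment> \<open>The contraction of \<open>b\<close> towards \<open>a0\<close> lies in
      \<open>B\<close> by convexity and in the ball, hence in \<open>T n\<close>.\<close>
    define a where "a = (1 - s) *\<^sub>R a0 + s *\<^sub>R b"
    have bD: "b \<in> D" using b by (simp add: B_def S_def)
    have aD: "a \<in> D" unfolding a_def using a0D bD subD by (intro subspace_add subspace_scale)
    have "q a \<le> (1 - s) * q a0 + s * q b"
      using add[OF subspace_scale[OF subD a0D] subspace_scale[OF subD bD], of "1 - s" s] s
      by (simp add: a_def scale a0D bD)
    also have "\<dots> \<le> 1"
      using a0 b s by (intro convex_bound_le) (auto simp: B_def S_def)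
    finally have "q a \<le> 1" .
    moreover have "norm a \<le> 1"
    proof -
      have "a \<in> cball 0 1" unfolding a_def
        using a0 b s by (intro convexD_alt[OF convex_cball]) (auto simp: B_def)
      then show ?thesis by simp
    qed
    ultimately have "a \<in> B" using aD by (simp add: B_def S_def)
    have "a - a0 = s *\<^sub>R (b - a0)" by (simp add: a_def algebra_simps)
    then have "norm (a - a0) = s * norm (b - a0)" using s by simp
    also have "\<dots> \<le> s * 2"
      using a0 b s norm_triangle_ineq4[of b a0] by (intro mult_left_mono) (auto simp: B_def)
    finally have "a \<in> ball a0 r" using s by (simp add: dist_norm norm_minus_commute)
    then have "a \<in> T n" using ball \<open>a \<in> B\<close> by blast
    then have qa: "q (\<alpha> a) \<le> k" using T_iff[OF aD] by (simp add: k_def)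
    have "\<alpha> a = (1 - s) *\<^sub>R \<alpha> a0 + s *\<^sub>R \<alpha> b"
      by (simp only: a_def linear_add[OF lin] linear_scale[OF lin])
    \<comment> \<open>Solving for \<open>\<alpha> b\<close> costs one more \<open>k\<close> from
      \<open>a0\<close> and the factor \<open>1 / s\<close>.\<close>
    then have "s *\<^sub>R \<alpha> b = \<alpha> a + (s - 1) *\<^sub>R \<alpha> a0" by (simp add: algebra_simps)
    then have "q (s *\<^sub>R \<alpha> b) \<le> q (\<alpha> a) + q ((s - 1) *\<^sub>R \<alpha> a0)"
      using add[OF \<alpha>D[OF aD] subspace_scale[OF subD \<alpha>D[OF a0D], of "s - 1"]] by simp
    then have "s * q (\<alpha> b) \<le> q (\<alpha> a) + (1 - s) * q (\<alpha> a0)"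
      using s by (simp add: scale \<alpha>D bD a0D)
    also have "(1 - s) * q (\<alpha> a0) \<le> 1 * k" using s qa0 q0 by (intro mult_mono) auto
    finally show ?thesis using qa s by (simp add: field_simps)
  qed
  obtain R where R: "R \<ge> 1" "\<And>a. a \<in> D \<Longrightarrow> L a \<le> 1 \<Longrightarrow> \<exists>t::real. norm (a - t *\<^sub>R 1) \<le> R"
    using lip_dom_radius[OF L] unfolding D_def by blast
  define C where "C = R * (2 * k / s)"
  have C: "C > 0" using R s by (simp add: C_def k_def)
  have one: "q (\<alpha> a) \<le> C" if a: "a \<in> D" "q a \<le> 1" for a
  proof -
    have "L a \<le> 1" using a by (simp add: Lq)
    then obtain t where t: "norm (a - t *\<^sub>R 1) \<le> R" using R(2) a by blast
    have t1: "u *\<^sub>R 1 \<in> D" "q (u *\<^sub>R 1) = 0" for u using null[of "u *\<^sub>R 1"] by blast+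
    \<comment> \<open>Since \<open>q\<close> ignores multiples of 1 and \<open>R >= 1\<close>, this
      normalization brings \<open>a\<close> into \<open>B\<close>.\<close>
    define b where "b = (1 / R) *\<^sub>R (a - t *\<^sub>R 1)"
    have aD: "a - t *\<^sub>R 1 \<in> D" using subspace_diff[OF subD a(1) t1(1)] .
    have "q (a - t *\<^sub>R 1) \<le> 1"
      using add[OF a(1) t1(1), of "- t"] t1(2)[of "- t"] a(2) by simp
    then have "b \<in> B"
      using R(1) t subspace_scale[OF subD aD] by (simp add: b_def B_def S_def scale[OF aD] divide_le_eq)
    then have "q (\<alpha> b) \<le> 2 * k / s" by (rule qB)
    moreover have "\<alpha> a = R *\<^sub>R \<alpha> b + t *\<^sub>R 1"
      using R(1) by (simp add: b_def linear_scale[OF lin] linear_diff[OF lin] star_automorphism_one[OF \<alpha>])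
    moreover have "\<alpha> b \<in> D" using \<open>b \<in> B\<close> \<alpha>D by (simp add: B_def S_def)
    ultimately have "q (\<alpha> a) \<le> R * q (\<alpha> b)"
      using add[OF subspace_scale[OF subD, of "\<alpha> b" R] t1(1)[of t]] t1(2)[of t] R(1) by (simp add: scale)
    also have "\<dots> \<le> C" unfolding C_def using R(1) \<open>q (\<alpha> b) \<le> 2 * k / s\<close> by (intro mult_left_mono) auto
    finally show ?thesis .
  qed
  have "L (\<alpha> a) \<le> ennreal C * L a" if a: "a \<in> self_adjoint" for a
  proof (cases "a \<in> D")
    case False
    then have "L a = \<infinity>" using a by (simp add: D_def lip_dom_def flip: top.not_eq_extremum)
    then show ?thesis using C by (simp add: ennreal_mult_top)
  next
    case aD: True
    have "q (\<alpha> a) \<le> C * q a"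
    \<comment> \<open>Scaling by \<open>1 / q a\<close> needs a nonzero value; where
      \<open>q\<close> vanishes, \<open>a\<close> is a multiple of 1 and fixed by \<alpha>.\<close>
    proof (cases "q a = 0")
      case True
      then obtain t where t: "a = t *\<^sub>R 1" using null[of a] aD by blast
      then have "\<alpha> a = a" by (simp add: linear_scale[OF lin] star_automorphism_one[OF \<alpha>])
      then show ?thesis using True by simp
    next
      case False
      with q0[of a] have qa: "q a > 0" by simp
      have "q (\<alpha> ((1 / q a) *\<^sub>R a)) \<le> C"
        using subspace_scale[OF subD aD] qa by (intro one) (simp_all add: scale[OF aD])
      then show ?thesis
        using qa by (simp add: linear_scale[OF lin] scale[OF \<alpha>D[OF aD]] field_simps)
    qed
    then show ?thesis using C q0[of a]
      by (simp add: Lq[OF aD] Lq[OF \<alpha>D[OF aD]] ennreal_leI flip: ennreal_mult)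
  qed
  then show ?thesis using that C by blast
qed

section \<open>Invariance of the domain and comparability of the seminorms\<close>

theorem corollary2p5:
  fixes L :: "'a::unital_cstar_algebra \<Rightarrow> ennreal"
    and \<alpha> :: "'a \<Rightarrow> 'a"
  assumes "quantum_compact_metric_space L"
    and "lip_lower_semicontinuous L"
    and "star_automorphism \<alpha>"
  shows "\<alpha> ` lip_dom L = lip_dom L \<longleftrightarrow>
    (\<exists>C::real. C > 0 \<and>
      (\<forall>a\<in>self_adjoint. ennreal (inverse C) * L (\<alpha> a) \<le> L a \<and> L a \<le> ennreal C * L (\<alpha> a)))"
proof
  have bij: "bij \<alpha>" using assms(3) by (simp add: star_automorphism_def)
  then have inv: "\<alpha> (inv \<alpha> x) = x" "inv \<alpha> (\<alpha> x) = x" for x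
    by (simp_all add: bij_is_surj surj_f_inv_f bij_is_inj)
  note sa = star_automorphism_self_adjoint_iff[OF assms(3)]
  {
    assume dom: "\<alpha> ` lip_dom L = lip_dom L"
    then have "inv \<alpha> ` lip_dom L = lip_dom L"
      by (metis bij bij_is_inj image_inv_f_f)
    then obtain C1 where C1: "C1 > 0" "\<And>a. a \<in> self_adjoint \<Longrightarrow> L (inv \<alpha> a) \<le> ennreal C1 * L a"
      using lip_dom_invariant_imp_bound[OF assms(1,2) star_automorphism_inv[OF assms(3)]] by blast
    obtain C2 where C2: "C2 > 0" "\<And>a. a \<in> self_adjoint \<Longrightarrow> L (\<alpha> a) \<le> ennreal C2 * L a"
      using lip_dom_invariant_imp_bound[OF assms] dom by blast
    define C where "C = max C1 C2"
    have C: "C > 0" "C1 \<le> C" "C2 \<le> C" using C1(1) by (auto simp: C_def)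
    have "ennreal (inverse C) * L (\<alpha> a) \<le> L a \<and> L a \<le> ennreal C * L (\<alpha> a)"
      if a: "a \<in> self_adjoint" for a
    proof
      have "L (\<alpha> a) \<le> ennreal C * L a"
        using C2(2)[OF a] C(3) by (meson ennreal_leI mult_right_mono order_trans zero_le)
      then have "ennreal (inverse C) * L (\<alpha> a) \<le> ennreal (inverse C) * (ennreal C * L a)"
        by (rule mult_left_mono) simp
      also have "\<dots> = L a" using C(1) by (simp flip: mult.assoc ennreal_mult)
      finally show "ennreal (inverse C) * L (\<alpha> a) \<le> L a" .
      show "L a \<le> ennreal C * L (\<alpha> a)"
        using C1(2)[of "\<alpha> a"] a C(2) unfolding sa inv
        by (meson ennreal_leI mult_right_mono order_trans zero_le)
    qed
    then show "\<exists>C::real. C > 0 \<and> (\<forall>a\<in>self_adjoint.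
        ennreal (inverse C) * L (\<alpha> a) \<le> L a \<and> L a \<le> ennreal C * L (\<alpha> a))"
      using C(1) by blast
  }
  assume "\<exists>C::real. C > 0 \<and> (\<forall>a\<in>self_adjoint.
        ennreal (inverse C) * L (\<alpha> a) \<le> L a \<and> L a \<le> ennreal C * L (\<alpha> a))"
  then obtain C :: real where C: "C > 0" "\<And>a. a \<in> self_adjoint \<Longrightarrow> ennreal (inverse C) * L (\<alpha> a) \<le> L a"
      "\<And>a. a \<in> self_adjoint \<Longrightarrow> L a \<le> ennreal C * L (\<alpha> a)" by blast
  \<comment> \<open>Each of the two inequalities transports finiteness in one direction, which is
    what invariance of the domain asks for.\<close>
  have fin: "L (\<alpha> a) < \<infinity> \<longleftrightarrow> L a < \<infinity>" if a: "a \<in> self_adjoint" for a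
  proof
    assume "L (\<alpha> a) < \<infinity>"
    then have "ennreal C * L (\<alpha> a) < \<infinity>" by (simp add: ennreal_mult_less_top)
    then show "L a < \<infinity>" using C(3)[OF a] by (rule le_less_trans[rotated])
  next
    assume "L a < \<infinity>"
    with C(2)[OF a] have "ennreal (inverse C) * L (\<alpha> a) < \<infinity>" by (rule le_less_trans)
    then show "L (\<alpha> a) < \<infinity>" using C(1) by (auto simp: ennreal_mult_less_top)
  qed
  show "\<alpha> ` lip_dom L = lip_dom L"
  proof (intro equalityI subsetI)
    fix b assume "b \<in> \<alpha> ` lip_dom L"
    then show "b \<in> lip_dom L" using fin sa by (auto simp: lip_dom_def)
  next
    fix b assume "b \<in> lip_dom L"
    then have "inv \<alpha> b \<in> lip_dom L" using fin[of "inv \<alpha> b"] sa[of "inv \<alpha> b"] by (simp add: lip_dom_def inv)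
    then show "b \<in> \<alpha> ` lip_dom L" by (metis image_eqI inv(1))
  qed
qed

end
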